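(* Let $\mathfrak{g}=\mathfrak{g}_L\ltimes\mathfrak{h}$ be a Lie algebra with simple Levi subalgebra $\mathfrak{g}_L$ and $\mathfrak{h}=\mathrm{Rad}(\mathfrak{g})$, satisfying $[\mathfrak{g},\mathfrak{g}]=\mathfrak{g}$ and $Z(\mathfrak{g})=0$, and such that $\mathfrak{h}$ is a direct sum of exactly three simple $\mathfrak{g}_L$-modules, $\mathfrak{h}=V_{n_1}\oplus V_{n_2}\oplus V_{n_3}$, with the property that whenever $[V_{n_i},V_{n_j}]\neq 0$ there is a unique $p\in\{1,2,3\}$ with $[V_{n_i},V_{n_j}]=V_{n_p}$. Then $\mathfrak{g}$ is not sympathetic.
   Context: All Lie algebras and vector spaces are finite dimensional over $\mathbb{C}$. A Lie algebra $\mathfrak{g}$ is sympathetic if $Z(\mathfrak{g})=0$, $\mathfrak{g}=[\mathfrak{g},\mathfrak{g}]$ and $\mathrm{Der}(\mathfrak{g})=\mathrm{ad}(\mathfrak{g})$. $\mathfrak{g}=\mathfrak{g}_L\ltimes\mathfrak{h}$ is a Levi decomposition, and $\mathfrak{h}$ is a $\mathfrak{g}_L$-module via the Lie bracket. Distinct summands may be isomorphic. $[A,B]$ denotes the linear span of all brackets $[a,b]$, $a\in A$, $b\in B$. *)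

theory Defs
  imports Complex_Main
begin

text \<open>
  The Lie algebra is the whole type \<open>'a\<close>; subalgebras, ideals and submodules are
  sets of type \<open>'a set\<close>.
\<close>

locale fd_complex_lie_algebra = vector_space scale
  for scale :: "complex \<Rightarrow> 'a::ab_group_add \<Rightarrow> 'a" +
  fixes br :: "'a \<Rightarrow> 'a \<Rightarrow> 'a"
  assumes finite_dim: "\<exists>B. finite B \<and> span B = UNIV"
    and linear_br_left: "Vector_Spaces.linear scale scale (\<lambda>x. br x y)"
    and linear_br_right: "Vector_Spaces.linear scale scale (\<lambda>y. br x y)"
    and br_self: "br x x = 0"
    and jacobi: "br x (br y z) + br y (br z x) + br z (br x y) = 0"
begin

definition brackets :: "'a set \<Rightarrow> 'a set \<Rightarrow> 'a set" where
  "brackets A B = span {br a b |a b. a \<in> A \<and> b \<in> B}"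

definition centre :: "'a set" where
  "centre = {x. \<forall>y. br x y = 0}"

definition derivations :: "('a \<Rightarrow> 'a) set" where
  "derivations = {D. Vector_Spaces.linear scale scale D \<and>
                     (\<forall>x y. D (br x y) = br (D x) y + br x (D y))}"

definition inner_derivations :: "('a \<Rightarrow> 'a) set" where
  "inner_derivations = {br x |x. True}"

definition sympathetic :: bool where
  "sympathetic \<longleftrightarrow>
     centre = {0} \<and> brackets UNIV UNIV = UNIV \<and> derivations = inner_derivations"

definition subalgebra :: "'a set \<Rightarrow> bool" where
  "subalgebra A \<longleftrightarrow> subspace A \<and> (\<forall>x\<in>A. \<forall>y\<in>A. br x y \<in> A)"

text \<open>Submodules of the ambient Lie algebra under the bracket action of a subalgebra \<open>L\<close>.\<close>

definition submodule :: "'a set \<Rightarrow> 'a set \<Rightarrow> bool" where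
  "submodule L W \<longleftrightarrow> subspace W \<and> (\<forall>x\<in>L. \<forall>w\<in>W. br x w \<in> W)"

definition simple_module :: "'a set \<Rightarrow> 'a set \<Rightarrow> bool" where
  "simple_module L V \<longleftrightarrow> submodule L V \<and> V \<noteq> {0} \<and>
     (\<forall>W. submodule L W \<and> W \<subseteq> V \<longrightarrow> W = {0} \<or> W = V)"

definition ideal_of :: "'a set \<Rightarrow> 'a set \<Rightarrow> bool" where
  "ideal_of I A \<longleftrightarrow> subspace I \<and> I \<subseteq> A \<and> (\<forall>x\<in>A. \<forall>y\<in>I. br x y \<in> I)"

primrec derived_series :: "'a set \<Rightarrow> nat \<Rightarrow> 'a set" where
  "derived_series A 0 = A"
| "derived_series A (Suc n) = brackets (derived_series A n) (derived_series A n)"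

definition solvable :: "'a set \<Rightarrow> bool" where
  "solvable A \<longleftrightarrow> (\<exists>n. derived_series A n = {0})"

text \<open>\<open>R\<close> is the radical, i.e. the largest solvable ideal, of the subalgebra \<open>A\<close>.\<close>

definition is_radical :: "'a set \<Rightarrow> 'a set \<Rightarrow> bool" where
  "is_radical R A \<longleftrightarrow> ideal_of R A \<and> solvable R \<and>
     (\<forall>I. ideal_of I A \<and> solvable I \<longrightarrow> I \<subseteq> R)"

definition semisimple :: "'a set \<Rightarrow> bool" where
  "semisimple A \<longleftrightarrow> subalgebra A \<and> is_radical {0} A"

definition simple :: "'a set \<Rightarrow> bool" where
  "simple A \<longleftrightarrow> subalgebra A \<and> brackets A A \<noteq> {0} \<and>
     (\<forall>I. ideal_of I A \<longrightarrow> I = {0} \<or> I = A)"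

definition levi_decomposition :: "'a set \<Rightarrow> 'a set \<Rightarrow> bool" where
  "levi_decomposition L H \<longleftrightarrow> semisimple L \<and> is_radical H UNIV \<and>
     {x + y |x y. x \<in> L \<and> y \<in> H} = UNIV \<and> L \<inter> H = {0}"

definition direct_sum :: "'i set \<Rightarrow> ('i \<Rightarrow> 'a set) \<Rightarrow> 'a set \<Rightarrow> bool" where
  "direct_sum I V H \<longleftrightarrow> finite I \<and> (\<forall>i\<in>I. subspace (V i)) \<and>
     H = {\<Sum>i\<in>I. v i |v. \<forall>i\<in>I. v i \<in> V i} \<and>
     (\<forall>v. (\<forall>i\<in>I. v i \<in> V i) \<and> (\<Sum>i\<in>I. v i) = 0 \<longrightarrow> (\<forall>i\<in>I. v i = 0))"

end

end

theory Submission
  imports Defs "HOL-Computational_Algebra.Fundamental_Theorem_Algebra"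
begin

text \<open>
  Since \<open>\<gg>\<close> is perfect, its radical \<open>\<hh>\<close> acts nilpotently: a solvable ideal
  has a nonzero common kernel on every nonzero module, because on a simple module an abelian
  ideal acts by scalars, and scalars that are sums of commutators are traceless. Hence
  \<open>[\<hh>, M] \<noteq> M\<close> for every nonzero ideal \<open>M\<close>, so the lower central series of
  \<open>\<hh>\<close>, all of whose terms are sums of the given summands, drops strictly. With three
  summands this forces a grading of \<open>\<hh>\<close> by positive degrees compatible with \<open>\<gg>\<^sub>L\<close>
  in degree 0. The corresponding degree derivation is not inner: if it were \<open>ad x\<close>, then
  \<open>x \<in> \<hh>\<close>, as it commutes with \<open>\<gg>\<^sub>L\<close>, and it would map \<open>\<hh>\<close> onto
  \<open>\<hh>\<close>, contradicting solvability.
\<close>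

section \<open>Endomorphisms of a finite-dimensional complex space\<close>

locale fd_complex_space = finite_dimensional_vector_space scale Basis
  for scale :: "complex \<Rightarrow> 'b::ab_group_add \<Rightarrow> 'b" and Basis
begin

abbreviation endo :: "('b \<Rightarrow> 'b) \<Rightarrow> bool" where
  "endo f \<equiv> Vector_Spaces.linear scale scale f"

lemma endo_add: "endo f \<Longrightarrow> f (x + y) = f x + f y"
  and endo_scale: "endo f \<Longrightarrow> f (scale c x) = scale c (f x)"
  by (auto simp: Vector_Spaces.linear_iff)

lemma endo_zero: "endo f \<Longrightarrow> f 0 = 0"
  by (metis endo_scale scale_zero_left)

lemma endo_neg: "endo f \<Longrightarrow> f (- x) = - f x"
  by (metis endo_add endo_zero add.right_inverse neg_eq_iff_add_eq_0)

lemma endo_diff: "endo f \<Longrightarrow> f (x - y) = f x - f y"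
  by (metis endo_add endo_neg diff_conv_add_uminus)

lemma endo_sum: "endo f \<Longrightarrow> f (sum g A) = (\<Sum>a\<in>A. f (g a))"
  by (induction A rule: infinite_finite_induct) (auto simp: endo_zero endo_add)

lemma endoI:
  "(\<And>x y. f (x + y) = f x + f y) \<Longrightarrow> (\<And>c x. f (scale c x) = scale c (f x)) \<Longrightarrow> endo f"
  using vector_space_axioms by (auto simp: Vector_Spaces.linear_iff)

lemma endo_compose: "endo f \<Longrightarrow> endo g \<Longrightarrow> endo (\<lambda>x. f (g x))"
  by (rule endoI) (simp_all add: endo_add endo_scale)

lemma endo_sub_scale: "endo f \<Longrightarrow> endo (\<lambda>x. f x - scale c x)"
  by (rule endoI) (simp_all add: endo_add endo_scale scale_right_distrib scale_right_diff_distrib mult.commute)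

section \<open>Polynomials in an endomorphism and eigenvectors\<close>

definition poly_act :: "('b \<Rightarrow> 'b) \<Rightarrow> complex poly \<Rightarrow> 'b \<Rightarrow> 'b" where
  "poly_act f p w = (\<Sum>i\<le>degree p. scale (coeff p i) ((f ^^ i) w))"

lemma poly_act_bound:
  assumes "degree p \<le> n"
  shows "poly_act f p w = (\<Sum>i\<le>n. scale (coeff p i) ((f ^^ i) w))"
  unfolding poly_act_def using assms
  by (intro sum.mono_neutral_left) (auto simp: coeff_eq_0)

text \<open>The product is \<open>smult (- r) q + pCons 0 q\<close>, and the shift
  \<open>pCons 0\<close> raises every power of \<open>f\<close> by one. This lets a root of
  \<open>p\<close> be split off as a factor \<open>f - r\<close>.\<close>

lemma poly_act_root:
  assumes f: "endo f"
  shows "poly_act f ([:- r, 1:] * q) w = f (poly_act f q w) - scale r (poly_act f q w)"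
proof -
  let ?n = "degree q"
  have d: "degree ([:- r, 1:] * q) \<le> Suc ?n"
    using degree_mult_le[of "[:- r, 1:]" q] by simp
  have d': "degree q \<le> Suc ?n" by simp
  have eq: "[:- r, 1:] * q = smult (- r) q + pCons 0 q" by simp
  have "poly_act f ([:- r, 1:] * q) w
      = (\<Sum>i\<le>Suc ?n. scale (- r) (scale (coeff q i) ((f ^^ i) w)))
        + (\<Sum>i\<le>Suc ?n. scale (coeff (pCons 0 q) i) ((f ^^ i) w))"
    unfolding poly_act_bound[OF d] unfolding eq sum.distrib[symmetric]
    by (intro sum.cong refl)
      (simp only: coeff_add coeff_smult scale_left_distrib scale_scale)
  also have "(\<Sum>i\<le>Suc ?n. scale (- r) (scale (coeff q i) ((f ^^ i) w))) = - scale r (poly_act f q w)"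
    unfolding poly_act_bound[OF d'] scale_sum_right[symmetric] by simp
  also have "(\<Sum>i\<le>Suc ?n. scale (coeff (pCons 0 q) i) ((f ^^ i) w)) = f (poly_act f q w)"
    by (simp only: sum.atMost_Suc_shift poly_act_def endo_sum[OF f])
      (simp add: endo_scale[OF f])
  finally show ?thesis by simp
qed

text \<open>The \<open>dimension + 1\<close> vectors \<open>w, f w, f (f w), ...\<close> either
  repeat or are linearly dependent, and either relation is a polynomial in \<open>f\<close> killing
  \<open>w\<close>.\<close>

lemma annihilating_poly_exists: "\<exists>p. p \<noteq> 0 \<and> poly_act f p w = 0"
proof (cases "inj_on (\<lambda>i. (f ^^ i) w) {..dimension}")
  case False
  then obtain i j where ij: "i \<noteq> j" "(f ^^ i) w = (f ^^ j) w"
    by (auto simp: inj_on_def)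
  \<comment> \<open>A repetition shrinks the set of iterates, so counting says nothing here; the
    repetition itself gives the relation X^i - X^j.\<close>
  let ?p = "monom 1 i - monom 1 j :: complex poly"
  have "degree ?p \<le> max i j"
    by (rule degree_diff_le) (auto simp: degree_monom_eq)
  then have "poly_act f ?p w = (\<Sum>k\<le>max i j. (if i = k then (f ^^ k) w else 0) - (if j = k then (f ^^ k) w else 0))"
    by (subst poly_act_bound) (auto intro!: sum.cong)
  also have "\<dots> = 0" using ij by (simp add: sum_subtractf)
  finally have "poly_act f ?p w = 0" .
  moreover have "coeff ?p i \<noteq> 0" using ij by simp
  then have "?p \<noteq> 0" by (metis coeff_0)
  ultimately show ?thesis by blast
next
  case True
  let ?g = "\<lambda>i. (f ^^ i) w"
  let ?S = "?g ` {..dimension}"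
  have "card ?S = Suc dimension" using True by (simp add: card_image)
  then have "dependent ?S"
    using independent_bound_general[of ?S] dim_subset_UNIV[of ?S] by auto
  then obtain u v where u: "v \<in> ?S" "u v \<noteq> 0" "(\<Sum>v\<in>?S. scale (u v) v) = 0"
    by (auto simp: dependent_finite)
  define p :: "complex poly" where "p = (\<Sum>i\<le>dimension. monom (u (?g i)) i)"
  have c: "coeff p i = (if i \<le> dimension then u (?g i) else 0)" for i
    unfolding p_def by (simp add: coeff_sum)
  have "degree p \<le> dimension" by (rule degree_le) (simp add: c)
  then have "poly_act f p w = (\<Sum>i\<le>dimension. scale (u (?g i)) (?g i))"
    by (simp add: poly_act_bound c)
  also have "\<dots> = 0" using u(3) by (simp add: sum.reindex[OF True])
  finally have "poly_act f p w = 0" .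
  moreover have "p \<noteq> 0" using u(1,2) c by (metis (no_types, lifting) atMost_iff coeff_0 imageE)
  ultimately show ?thesis by blast
qed

lemma subspace_funpow: "f ` W \<subseteq> W \<Longrightarrow> w \<in> W \<Longrightarrow> (f ^^ i) w \<in> W"
  by (induction i) auto

text \<open>Take \<open>p\<close> of least degree with \<open>p(f) w = 0\<close> and split off a
  root, \<open>p = (X - r) q\<close>. By minimality \<open>q(f) w\<close> is nonzero, and
  \<open>f - r\<close> kills it.\<close>

lemma eigenvector_exists:
  assumes f: "endo f" and W: "subspace W" "f ` W \<subseteq> W" "W \<noteq> {0}"
  obtains r w where "w \<in> W" "w \<noteq> 0" "f w = scale r w"
proof -
  obtain w where w: "w \<in> W" "w \<noteq> 0" using W(1,3) subspace_0 by blast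
  obtain p where p: "p \<noteq> 0 \<and> poly_act f p w = 0"
    and least: "\<And>q. q \<noteq> 0 \<and> poly_act f q w = 0 \<Longrightarrow> degree p \<le> degree q"
    using ex_has_least_nat[of "\<lambda>p. p \<noteq> 0 \<and> poly_act f p w = 0" _ degree]
      annihilating_poly_exists[of f w] by metis
  have "degree p \<noteq> 0"
  proof
    assume "degree p = 0"
    then have "poly_act f p w = scale (coeff p 0) w" by (simp add: poly_act_def)
    then have "coeff p 0 = 0" using p w by simp
    then show False using p \<open>degree p = 0\<close> leading_coeff_neq_0 by metis
  qed
  then obtain r where "poly p r = 0" using alg_closed_imp_poly_has_root[of p] by auto
  then obtain q where q: "p = [:- r, 1:] * q" by (auto simp: poly_eq_0_iff_dvd)
  have "q \<noteq> 0" using p q by auto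
  then have "degree q < degree p" unfolding q by (subst degree_mult_eq) auto
  then have "poly_act f q w \<noteq> 0" using least[of q] \<open>q \<noteq> 0\<close> by auto
  moreover have "poly_act f q w \<in> W"
    unfolding poly_act_def by (intro subspace_sum subspace_scale W subspace_funpow w)
  moreover have "f (poly_act f q w) = scale r (poly_act f q w)"
    using poly_act_root[OF f, of r q w] p q by simp
  ultimately show thesis using that by blast
qed

section \<open>Traces on the span of an independent set\<close>

definition trace_on :: "'b set \<Rightarrow> ('b \<Rightarrow> 'b) \<Rightarrow> complex" where
  "trace_on B f = (\<Sum>b\<in>B. representation B (f b) b)"

lemma trace_on_add:
  assumes "independent B" "\<And>b. b \<in> B \<Longrightarrow> f b \<in> span B" "\<And>b. b \<in> B \<Longrightarrow> g b \<in> span B"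
  shows "trace_on B (\<lambda>x. f x + g x) = trace_on B f + trace_on B g"
  unfolding trace_on_def sum.distrib[symmetric]
  using assms by (intro sum.cong) (simp_all add: representation_add)

lemma trace_on_diff:
  assumes "independent B" "\<And>b. b \<in> B \<Longrightarrow> f b \<in> span B" "\<And>b. b \<in> B \<Longrightarrow> g b \<in> span B"
  shows "trace_on B (\<lambda>x. f x - g x) = trace_on B f - trace_on B g"
  unfolding trace_on_def sum_subtractf[symmetric]
  using assms by (intro sum.cong) (simp_all add: representation_diff)

lemma trace_on_scale:
  assumes "independent B" "\<And>b. b \<in> B \<Longrightarrow> f b \<in> span B"
  shows "trace_on B (\<lambda>x. scale c (f x)) = c * trace_on B f"
  unfolding trace_on_def sum_distrib_left
  using assms by (intro sum.cong) (simp_all add: representation_scale)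

lemma trace_on_homothety:
  assumes "independent B"
  shows "trace_on B (\<lambda>x. scale c x) = c * of_nat (card B)"
  unfolding trace_on_def
  by (simp add: representation_scale representation_basis assms span_base)

lemma trace_on_cong: "(\<And>b. b \<in> B \<Longrightarrow> f b = g b) \<Longrightarrow> trace_on B f = trace_on B g"
  by (simp add: trace_on_def)

text \<open>This is the trace of a matrix product in the basis \<open>B\<close>. The double sum is
  symmetric in the two maps up to swapping indices, so commutators turn out traceless.\<close>

lemma trace_on_comp:
  assumes B: "independent B" and f: "endo f" "\<And>b. b \<in> B \<Longrightarrow> f b \<in> span B"
    and g: "\<And>b. b \<in> B \<Longrightarrow> g b \<in> span B"
  shows "trace_on B (\<lambda>x. f (g x)) = (\<Sum>b\<in>B. \<Sum>c\<in>B. representation B (g b) c * representation B (f c) b)"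
  unfolding trace_on_def
proof (rule sum.cong[OF refl])
  fix b assume b: "b \<in> B"
  have fin: "finite B" using B by (rule finiteI_independent)
  have "g b = (\<Sum>c\<in>B. scale (representation B (g b) c) c)"
    using sum_representation_eq[OF B g[OF b] fin subset_refl] by simp
  then have "f (g b) = f (\<Sum>c\<in>B. scale (representation B (g b) c) c)"
    by (rule arg_cong)
  also have "\<dots> = (\<Sum>c\<in>B. scale (representation B (g b) c) (f c))"
    by (simp add: endo_sum[OF f(1)] endo_scale[OF f(1)])
  finally have "representation B (f (g b)) = representation B (\<Sum>c\<in>B. scale (representation B (g b) c) (f c))"
    by simp
  also have "\<dots> = (\<lambda>d. \<Sum>c\<in>B. representation B (scale (representation B (g b) c) (f c)) d)"
    by (rule representation_sum[OF B]) (simp add: f span_scale)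
  finally show "representation B (f (g b)) b = (\<Sum>c\<in>B. representation B (g b) c * representation B (f c) b)"
    using B f(2) by (simp add: representation_scale)
qed

lemma trace_on_commute:
  assumes "independent B" "endo f" "\<And>b. b \<in> B \<Longrightarrow> f b \<in> span B"
    and "endo g" "\<And>b. b \<in> B \<Longrightarrow> g b \<in> span B"
  shows "trace_on B (\<lambda>x. f (g x)) = trace_on B (\<lambda>x. g (f x))"
  by (simp add: trace_on_comp assms mult.commute) (rule sum.swap)

section \<open>Minimal and maximal invariant subspaces\<close>

lemma minimal_subspace_exists:
  assumes "P W" "subspace W" "W \<noteq> {0}"
  shows "\<exists>U. P U \<and> subspace U \<and> U \<noteq> {0} \<and> U \<subseteq> W \<and>
    (\<forall>T. P T \<longrightarrow> subspace T \<longrightarrow> T \<noteq> {0} \<longrightarrow> T \<subseteq> U \<longrightarrow> T = U)"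
proof -
  let ?Q = "\<lambda>U. P U \<and> subspace U \<and> U \<noteq> {0} \<and> U \<subseteq> W"
  obtain U where U: "?Q U" "\<And>T. ?Q T \<Longrightarrow> dim U \<le> dim T"
    using ex_has_least_nat[of ?Q W dim] assms by blast
  have "T = U" if "P T" "subspace T" "T \<noteq> {0}" "T \<subseteq> U" for T
    using U(2)[of T] U(1) that by (intro subspace_dim_equal) auto
  then show ?thesis using U(1) by (intro exI[of _ U]) simp
qed

text \<open>A subspace of greatest dimension will do, since dimensions are bounded. With
  \<open>P\<close> read as invariance, \<open>M / U\<close> is a simple module.\<close>

lemma maximal_subspace_exists:
  assumes "P W" "subspace W" "W \<subset> M"
  shows "\<exists>U. P U \<and> subspace U \<and> U \<subset> M \<and>
    (\<forall>T. P T \<longrightarrow> subspace T \<longrightarrow> U \<subseteq> T \<longrightarrow> T \<subset> M \<longrightarrow> T = U)"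
proof -
  let ?Q = "\<lambda>U. P U \<and> subspace U \<and> U \<subset> M"
  have "\<exists>U. ?Q U \<and> (\<forall>T. ?Q T \<longrightarrow> dim T \<le> dim U)"
    using ex_has_greatest_nat[of ?Q W dim "Suc dimension"] assms dim_subset_UNIV
    by (auto simp: less_Suc_eq_le)
  then obtain U where U: "?Q U" "\<And>T. ?Q T \<Longrightarrow> dim T \<le> dim U" by blast
  have "T = U" if "P T" "subspace T" "U \<subseteq> T" "T \<subset> M" for T
    using U(2)[of T] U(1) that by (intro subspace_dim_equal[symmetric]) auto
  then show ?thesis using U(1) by (intro exI[of _ U]) simp
qed

text \<open>Let \<open>U\<close> be a minimal nonzero subspace stable under all of \<open>A\<close>.
  Each \<open>f\<close> in \<open>A\<close> has an eigenvector in \<open>U\<close>, and its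
  eigenspace in \<open>U\<close> is stable under the maps commuting with \<open>f\<close>, hence
  equals \<open>U\<close>. So every nonzero vector of \<open>U\<close> works.\<close>

lemma common_eigenvector_exists:
  assumes endo: "\<And>f. f \<in> A \<Longrightarrow> endo f" and W: "subspace W" "W \<noteq> {0}"
    and inv: "\<And>f. f \<in> A \<Longrightarrow> f ` W \<subseteq> W"
    and comm: "\<And>f g w. f \<in> A \<Longrightarrow> g \<in> A \<Longrightarrow> w \<in> W \<Longrightarrow> f (g w) = g (f w)"
  shows "\<exists>w\<in>W. w \<noteq> 0 \<and> (\<forall>f\<in>A. \<exists>c. f w = scale c w)"
proof -
  have stable: "\<forall>f\<in>A. f ` W \<subseteq> W" using inv by simp
  obtain U where U: "\<forall>f\<in>A. f ` U \<subseteq> U" "subspace U" "U \<noteq> {0}" "U \<subseteq> W"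
    and min: "\<forall>T. (\<forall>f\<in>A. f ` T \<subseteq> T) \<longrightarrow> subspace T \<longrightarrow> T \<noteq> {0} \<longrightarrow> T \<subseteq> U \<longrightarrow> T = U"
    using minimal_subspace_exists[of "\<lambda>U. \<forall>f\<in>A. f ` U \<subseteq> U", OF stable W]
    by (elim exE conjE) (rule that)
  have "\<exists>r. \<forall>u\<in>U. f u = scale r u" if f: "f \<in> A" for f
  proof -
    have ef: "endo f" using endo[OF f] .
    obtain r w where w: "w \<in> U" "w \<noteq> 0" "f w = scale r w"
      by (rule eigenvector_exists[OF ef U(2) bspec[OF U(1) f] U(3)])
    let ?T = "{u \<in> U. f u = scale r u}"
    have "?T = U"
    proof (rule min[THEN spec, THEN mp, THEN mp, THEN mp, THEN mp])
      show "subspace ?T"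
        using U(2) by (auto intro!: subspaceI simp: subspace_0 subspace_add subspace_scale
            endo_add[OF ef] endo_scale[OF ef] endo_zero[OF ef] scale_right_distrib mult.commute)
      show "\<forall>g\<in>A. g ` ?T \<subseteq> ?T"
      proof (intro ballI image_subsetI)
        fix g u assume g: "g \<in> A" and u: "u \<in> ?T"
        have "f (g u) = g (f u)" using comm[OF f g] u U(4) by auto
        also have "\<dots> = scale r (g u)" using u endo_scale[OF endo[OF g]] by simp
        finally show "g u \<in> ?T" using u U(1) g by auto
      qed
    qed (use w in auto)
    then show ?thesis by auto
  qed
  moreover obtain w where "w \<in> U" "w \<noteq> 0" using U(2,3) subspace_0 by blast
  ultimately show ?thesis using U(4) by blast
qed

section \<open>Generalised kernels, nilpotency and projections\<close>

lemma funpow_eq_0_mono: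
  assumes "endo f" "(f ^^ m) w = 0" "m \<le> n"
  shows "(f ^^ n) w = 0"
proof -
  have "(f ^^ j) 0 = 0" for j by (induction j) (simp_all add: endo_zero[OF assms(1)])
  then show ?thesis using assms(2,3) by (metis comp_apply funpow_add le_add_diff_inverse2)
qed

lemma endo_funpow: "endo f \<Longrightarrow> endo (f ^^ n)"
  by (induction n) (auto intro!: endoI simp: endo_add endo_scale)

lemma subspace_gen_eigenspace:
  assumes f: "endo f" and U: "subspace U"
  shows "subspace {u \<in> U. \<exists>m. (f ^^ m) u = 0}"
proof (rule subspaceI)
  show "0 \<in> {u \<in> U. \<exists>m. (f ^^ m) u = 0}" using U subspace_0 by (auto intro: exI[of _ 0])
next
  fix x y assume "x \<in> {u \<in> U. \<exists>m. (f ^^ m) u = 0}" "y \<in> {u \<in> U. \<exists>m. (f ^^ m) u = 0}"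
  then obtain m n where mn: "x \<in> U" "y \<in> U" "(f ^^ m) x = 0" "(f ^^ n) y = 0" by blast
  have "(f ^^ (max m n)) (x + y) = 0"
    using funpow_eq_0_mono[OF f mn(3), of "max m n"] funpow_eq_0_mono[OF f mn(4), of "max m n"]
    by (simp add: endo_add[OF endo_funpow[OF f]])
  then show "x + y \<in> {u \<in> U. \<exists>m. (f ^^ m) u = 0}" using mn U subspace_add by blast
next
  fix c x assume "x \<in> {u \<in> U. \<exists>m. (f ^^ m) u = 0}"
  then show "scale c x \<in> {u \<in> U. \<exists>m. (f ^^ m) u = 0}"
    using U subspace_scale by (fastforce simp: endo_scale[OF endo_funpow[OF f]])
qed

text \<open>A basis of \<open>U\<close> is finite, so the exponents of its members have a common
  bound; their sum is a convenient one.\<close>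

lemma uniform_nilpotency_index:
  assumes f: "endo f" and U: "subspace U" and nil: "\<And>u. u \<in> U \<Longrightarrow> \<exists>m. (f ^^ m) u = 0"
  shows "\<exists>n. \<forall>u\<in>U. (f ^^ n) u = 0"
proof -
  obtain B where B: "B \<subseteq> U" "independent B" "U \<subseteq> span B"
    by (rule basis_exists[of U]) (rule that)
  have fin: "finite B" using B(2) by (rule finiteI_independent)
  have "\<forall>b\<in>B. \<exists>m. (f ^^ m) b = 0" by (intro ballI nil subsetD[OF B(1)])
  from bchoice[OF this] obtain m where m: "\<forall>b\<in>B. (f ^^ m b) b = 0" by (elim exE)
  define n where "n = (\<Sum>b\<in>B. m b)"
  have "(f ^^ n) b = 0" if b: "b \<in> B" for b
  proof (rule funpow_eq_0_mono[OF f])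
    show "(f ^^ m b) b = 0" using m b by (rule bspec)
    show "m b \<le> n" unfolding n_def by (rule member_le_sum[OF b _ fin]) simp
  qed
  moreover have "subspace {u. (f ^^ n) u = 0}"
    using endo_funpow[OF f, of n]
    by (intro subspaceI) (simp_all only: mem_Collect_eq endo_zero endo_add endo_scale add_0_left scale_zero_right)
  ultimately have "span B \<subseteq> {u. (f ^^ n) u = 0}" by (intro span_minimal subsetI) simp_all
  then have "\<forall>u\<in>U. (f ^^ n) u = 0" using B(3) by blast
  then show ?thesis by (rule exI)
qed

text \<open>Extend a basis of \<open>S\<close> to the whole space and send the members in
  \<open>S\<close> to 0. The kernel is then exactly \<open>S\<close>, so the image of
  \<open>p\<close> models the quotient by \<open>S\<close>.\<close>

lemma projection_exists:
  assumes "subspace S"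
  shows "\<exists>p. endo p \<and> (\<forall>x\<in>S. p x = 0) \<and> (\<forall>x. x - p x \<in> S)"
proof -
  interpret vector_space_pair scale scale by unfold_locales
  obtain B where B: "B \<subseteq> S" "independent B" "S \<subseteq> span B" by (rule basis_exists[of S]) (rule that)
  obtain C where C: "B \<subseteq> C" "independent C" "span C = UNIV"
    using maximal_independent_subset_extend[OF subset_UNIV B(2)] by (metis top.extremum_uniqueI)
  obtain p where p: "endo p" "\<And>x. x \<in> C \<Longrightarrow> p x = (if x \<in> B then 0 else x)"
    using linear_independent_extend[OF C(2), of "\<lambda>x. if x \<in> B then 0 else x"] by blast
  have "span B \<subseteq> {x. p x = 0}"
    using p C(1) by (intro span_minimal)
      (auto intro!: subspaceI simp: endo_zero endo_add endo_scale)
  moreover have "span C \<subseteq> {x. x - p x \<in> S}"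
  proof (rule span_minimal)
    show "C \<subseteq> {x. x - p x \<in> S}" using p(2) B(1) subspace_0[OF assms] by auto
    show "subspace {x. x - p x \<in> S}"
    proof (rule subspaceI; clarsimp)
      show "- p 0 \<in> S" using subspace_0[OF assms] by (simp add: endo_zero[OF p(1)])
    next
      fix x y assume "x - p x \<in> S" "y - p y \<in> S"
      then have "(x - p x) + (y - p y) \<in> S" by (rule subspace_add[OF assms])
      then show "x + y - p (x + y) \<in> S" by (simp add: endo_add[OF p(1)] algebra_simps)
    next
      fix c x assume "x - p x \<in> S"
      then have "scale c (x - p x) \<in> S" by (rule subspace_scale[OF assms])
      then show "scale c x - p (scale c x) \<in> S"
        by (simp add: endo_scale[OF p(1)] scale_right_diff_distrib)
    qed
  qed
  ultimately show ?thesis using p(1) B(3) C(3) by (intro exI[of _ p]) auto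
qed

end

section \<open>Solvable ideals of a perfect Lie algebra\<close>

context fd_complex_lie_algebra
begin

text \<open>The locale of finite-dimensional spaces takes a basis as a parameter, whereas the Lie
  algebra only asserts a finite spanning set; Hilbert choice supplies a fixed basis.\<close>

lemma fd_complex_space_some_basis:
  "fd_complex_space scale (SOME B. independent B \<and> finite B \<and> span B = UNIV)"
proof -
  obtain S where S: "finite S" "span S = UNIV" using finite_dim by blast
  obtain B where B: "B \<subseteq> S" "independent B" "S \<subseteq> span B"
    using maximal_independent_subset[of S] by blast
  have "span B = UNIV" using span_minimal[OF B(3) subspace_span] S(2) by auto
  then have "\<exists>B. independent B \<and> finite B \<and> span B = UNIV"
    using B finite_subset[OF B(1) S(1)] by blast
  from someI_ex[OF this] show ?thesis
    unfolding fd_complex_space_def by unfold_locales simp_all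
qed

sublocale fd_complex_space scale "SOME B. independent B \<and> finite B \<and> span B = UNIV"
  by (rule fd_complex_space_some_basis)

section \<open>Calculus of brackets and ideals\<close>

lemmas br_add_left = endo_add[OF linear_br_left]
  and br_add_right = endo_add[OF linear_br_right]
  and br_diff_right = endo_diff[OF linear_br_right]
  and br_scale_left = endo_scale[OF linear_br_left]
  and br_scale_right = endo_scale[OF linear_br_right]
  and br_zero_left = endo_zero[OF linear_br_left]
  and br_zero_right = endo_zero[OF linear_br_right]
  and br_neg_left = endo_neg[OF linear_br_left]
  and br_neg_right = endo_neg[OF linear_br_right]
  and br_sum_left = endo_sum[OF linear_br_left]
  and br_sum_right = endo_sum[OF linear_br_right]

lemma br_antisym: "br x y = - br y x"
proof -
  have "br (x + y) (x + y) = br x y + br y x"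
    by (simp only: br_add_left br_add_right) (simp add: br_self)
  then show ?thesis by (simp add: br_self eq_neg_iff_add_eq_0)
qed

lemma jacobi_derivation: "br x (br y z) = br (br x y) z + br y (br x z)"
proof -
  have "br z (br x y) = - br (br x y) z" by (rule br_antisym)
  moreover have "br y (br z x) = - br y (br x z)"
    unfolding br_antisym[of z x] by (rule br_neg_right)
  ultimately show ?thesis
    using jacobi[of x y z] by (simp only:) (simp add: algebra_simps eq_neg_iff_add_eq_0)
qed

lemma br_br: "br (br x y) z = br x (br y z) - br y (br x z)"
  by (simp add: jacobi_derivation[of x y z])

lemma subspace_brackets: "subspace (brackets A B)"
  by (simp add: brackets_def)

lemma br_in_brackets: "a \<in> A \<Longrightarrow> b \<in> B \<Longrightarrow> br a b \<in> brackets A B"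
  unfolding brackets_def by (rule span_base) blast

lemma brackets_least:
  "subspace S \<Longrightarrow> (\<And>a b. a \<in> A \<Longrightarrow> b \<in> B \<Longrightarrow> br a b \<in> S) \<Longrightarrow> brackets A B \<subseteq> S"
  unfolding brackets_def by (rule span_minimal) auto

lemma brackets_mono: "A \<subseteq> A' \<Longrightarrow> B \<subseteq> B' \<Longrightarrow> brackets A B \<subseteq> brackets A' B'"
  unfolding brackets_def by (rule span_mono) blast

lemma brackets_commute: "brackets A B = brackets B A"
proof -
  have "brackets A B \<subseteq> brackets B A" for A B
    by (intro brackets_least subspace_brackets)
      (metis br_antisym br_in_brackets subspace_brackets subspace_neg)
  then show ?thesis by blast
qed

lemma subspace_br_vimage: "subspace S \<Longrightarrow> subspace {z. br x z \<in> S}"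
  by (auto intro!: subspaceI simp: br_zero_right br_add_right br_scale_right
      subspace_0 subspace_add subspace_scale)

text \<open>By the Jacobi identity \<open>br x\<close> acts on a bracket as a derivation, and each
  ideal absorbs \<open>br x\<close> in its own factor. Generators suffice, because the preimage of a
  subspace under \<open>br x\<close> is a subspace.\<close>

lemma ideal_brackets:
  assumes I: "ideal_of I UNIV" and J: "ideal_of J UNIV"
  shows "ideal_of (brackets I J) UNIV"
proof -
  have "brackets I J \<subseteq> {z. br x z \<in> brackets I J}" for x
  proof (rule brackets_least[OF subspace_br_vimage[OF subspace_brackets]])
    fix a b assume "a \<in> I" "b \<in> J"
    moreover have "br x a \<in> I" "br x b \<in> J"
      using I J calculation by (auto simp: ideal_of_def)
    ultimately show "br a b \<in> {z. br x z \<in> brackets I J}"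
      by (auto simp: jacobi_derivation[of x a b] intro!: subspace_add subspace_brackets br_in_brackets)
  qed
  then show ?thesis by (auto simp: ideal_of_def subspace_brackets)
qed

lemma ideal_derived_series: "ideal_of I UNIV \<Longrightarrow> ideal_of (derived_series I n) UNIV"
  by (induction n) (auto intro: ideal_brackets)

section \<open>Representations and the common kernel of a solvable ideal\<close>

text \<open>Modules are carried by subspaces of \<open>'a\<close> itself; a quotient module \<open>M / S\<close> is realised
  on a complement of \<open>S\<close> via a projection.\<close>

definition lie_rep :: "('a \<Rightarrow> 'a \<Rightarrow> 'a) \<Rightarrow> 'a set \<Rightarrow> bool" where
  "lie_rep \<rho> W \<longleftrightarrow> subspace W \<and> (\<forall>x. endo (\<rho> x) \<and> \<rho> x ` W \<subseteq> W) \<and>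
     (\<forall>w. endo (\<lambda>x. \<rho> x w)) \<and>
     (\<forall>x y. \<forall>w\<in>W. \<rho> (br x y) w = \<rho> x (\<rho> y w) - \<rho> y (\<rho> x w))"

lemma lie_repD:
  assumes "lie_rep \<rho> W"
  shows "subspace W" "endo (\<rho> x)" "\<rho> x ` W \<subseteq> W" "w \<in> W \<Longrightarrow> \<rho> x w \<in> W" "endo (\<lambda>x. \<rho> x v)"
    "w \<in> W \<Longrightarrow> \<rho> (br x y) w = \<rho> x (\<rho> y w) - \<rho> y (\<rho> x w)"
  using assms by (auto simp: lie_rep_def)

lemma lie_rep_subspace:
  "lie_rep \<rho> W \<Longrightarrow> subspace U \<Longrightarrow> U \<subseteq> W \<Longrightarrow> (\<And>x. \<rho> x ` U \<subseteq> U) \<Longrightarrow> lie_rep \<rho> U"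
  by (auto simp: lie_rep_def subset_iff)

text \<open>For \<open>A = \<rho> (br x k)\<close> one has
  \<open>N (\<rho> x v) = \<rho> x (N v) - A v\<close>, and \<open>A\<close> commutes with
  \<open>N\<close> by assumption. Moving \<open>\<rho> x\<close> past \<open>m + 1\<close> factors
  \<open>N\<close> thus produces \<open>m + 1\<close> equal terms.\<close>

lemma funpow_commutator:
  fixes r :: complex
  assumes rep: "lie_rep \<rho> W" and a: "\<And>w. w \<in> W \<Longrightarrow> \<rho> (br x k) (\<rho> k w) = \<rho> k (\<rho> (br x k) w)"
    and w: "w \<in> W"
  defines "N \<equiv> \<lambda>w. \<rho> k w - scale r w"
  shows "(N ^^ Suc m) (\<rho> x w)
    = \<rho> x ((N ^^ Suc m) w) - scale (of_nat (Suc m)) (\<rho> (br x k) ((N ^^ m) w))"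
proof -
  note rho = lie_repD[OF rep]
  have NW: "N w \<in> W" if "w \<in> W" for w
    using that rho by (simp add: N_def subspace_diff subspace_scale)
  have N: "endo N" unfolding N_def by (rule endo_sub_scale[OF rho(2)])
  have Nx: "N (\<rho> x v) = \<rho> x (N v) - \<rho> (br x k) v" if "v \<in> W" for v
    using that by (simp add: N_def rho(6) endo_diff[OF rho(2)] endo_scale[OF rho(2)])
  have Na: "N (\<rho> (br x k) v) = \<rho> (br x k) (N v)" if "v \<in> W" for v
    using that by (simp add: N_def endo_diff[OF rho(2)] endo_scale[OF rho(2)] a)
  have iter: "(N ^^ m) w \<in> W" for m using w NW by (intro subspace_funpow) auto
  show ?thesis
  proof (induction m)
    case 0
    then show ?case using w by (simp add: Nx)
  next
    case (Suc m)
    have "(N ^^ Suc (Suc m)) (\<rho> x w) = N ((N ^^ Suc m) (\<rho> x w))" by simp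
    also have "\<dots> = N (\<rho> x ((N ^^ Suc m) w)) - scale (of_nat (Suc m)) (N (\<rho> (br x k) ((N ^^ m) w)))"
      unfolding Suc.IH by (simp only: endo_diff[OF N] endo_scale[OF N])
    also have "\<dots> = \<rho> x (N ((N ^^ Suc m) w)) - \<rho> (br x k) ((N ^^ Suc m) w)
        - scale (of_nat (Suc m)) (\<rho> (br x k) (N ((N ^^ m) w)))"
      by (simp only: Nx[OF iter] Na[OF iter])
    finally show ?case
      unfolding of_nat_Suc[of "Suc m"] scale_left_distrib by (simp del: of_nat_Suc)
  qed
qed

text \<open>Elements acting with trace 0 form a subspace, which contains all brackets because
  commutators are traceless; perfectness makes it everything.\<close>

lemma trace_rep_perfect:
  assumes perfect: "brackets UNIV UNIV = UNIV" and rep: "lie_rep \<rho> U"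
    and B: "independent B" "span B = U"
  shows "trace_on B (\<rho> x) = 0"
proof -
  note rho = lie_repD[OF rep]
  have BU: "b \<in> U" if "b \<in> B" for b using B(2) that span_base by blast
  have in_span: "\<rho> x b \<in> span B" if "b \<in> U" for x b using rho(4) that B(2) by blast
  have "brackets UNIV UNIV \<subseteq> {x. trace_on B (\<rho> x) = 0}"
  proof (rule brackets_least)
    show "subspace {x. trace_on B (\<rho> x) = 0}"
    proof (rule subspaceI; clarsimp)
      show "trace_on B (\<rho> 0) = 0"
        by (simp add: trace_on_def endo_zero[OF rho(5)] representation_zero)
    next
      fix x y assume "trace_on B (\<rho> x) = 0" "trace_on B (\<rho> y) = 0"
      then show "trace_on B (\<rho> (x + y)) = 0"
        using trace_on_add[of B "\<rho> x" "\<rho> y"] B(1) in_span BU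
        by (simp add: trace_on_def endo_add[OF rho(5)])
    next
      fix c x assume "trace_on B (\<rho> x) = 0"
      then show "trace_on B (\<rho> (scale c x)) = 0"
        using trace_on_scale[of B "\<rho> x" c] B(1) in_span BU
        by (simp add: trace_on_def endo_scale[OF rho(5)])
    qed
  next
    fix x y
    have "trace_on B (\<rho> (br x y)) = trace_on B (\<lambda>b. \<rho> x (\<rho> y b) - \<rho> y (\<rho> x b))"
      by (rule trace_on_cong) (rule rho(6)[OF BU])
    also have "\<dots> = 0"
    proof -
      have "\<rho> x b \<in> span B" "\<rho> x (\<rho> y b) \<in> span B" if "b \<in> B" for b x y
        using BU[OF that] in_span rho(4) by simp_all
      then show ?thesis
        using trace_on_commute[of B "\<rho> x" "\<rho> y"] rho(2) B(1) by (simp add: trace_on_diff)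
    qed
    finally show "br x y \<in> {x. trace_on B (\<rho> x) = 0}" by simp
  qed
  then show ?thesis unfolding perfect by auto
qed

text \<open>On a simple submodule \<open>U\<close> the commuting operators have a common eigenvector
  \<open>w\<close> with eigenvalues \<open>r k\<close>. First \<open>r\<close> is shown to vanish on
  \<open>br x k\<close>; then the joint eigenspace is a submodule, so \<open>K\<close> acts on
  \<open>U\<close> by scalars, and tracelessness makes these scalars zero.\<close>

lemma commuting_ideal_kernel:
  assumes perfect: "brackets UNIV UNIV = UNIV" and rep: "lie_rep \<rho> W" and "W \<noteq> {0}"
    and K: "\<And>x k. k \<in> K \<Longrightarrow> br x k \<in> K"
    and commW: "\<And>k l w. k \<in> K \<Longrightarrow> l \<in> K \<Longrightarrow> w \<in> W \<Longrightarrow> \<rho> k (\<rho> l w) = \<rho> l (\<rho> k w)"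
  shows "\<exists>w\<in>W. w \<noteq> 0 \<and> (\<forall>k\<in>K. \<rho> k w = 0)"
proof -
  obtain U where U: "\<forall>x. \<rho> x ` U \<subseteq> U" "subspace U" "U \<noteq> {0}" "U \<subseteq> W"
    and min: "\<forall>T. (\<forall>x. \<rho> x ` T \<subseteq> T) \<longrightarrow> subspace T \<longrightarrow> T \<noteq> {0} \<longrightarrow> T \<subseteq> U \<longrightarrow> T = U"
    using minimal_subspace_exists[of "\<lambda>U. \<forall>x. \<rho> x ` U \<subseteq> U" W,
        OF allI[OF lie_repD(3)[OF rep]] lie_repD(1)[OF rep] assms(3)]
    by (elim exE conjE) (rule that)
  have repU: "lie_rep \<rho> U" using lie_rep_subspace[OF rep U(2,4)] U(1) by blast
  note rho = lie_repD[OF repU]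
  have comm: "\<rho> k (\<rho> l w) = \<rho> l (\<rho> k w)" if "k \<in> K" "l \<in> K" "w \<in> U" for k l w
    using commW that U(4) by blast
  have "\<exists>w\<in>U. w \<noteq> 0 \<and> (\<forall>f\<in>\<rho> ` K. \<exists>c. f w = scale c w)"
  proof (rule common_eigenvector_exists)
    show "endo f" "f ` U \<subseteq> U" if "f \<in> \<rho> ` K" for f
      using that rho(2,3) by auto
    show "f (g w) = g (f w)" if "f \<in> \<rho> ` K" "g \<in> \<rho> ` K" "w \<in> U" for f g w
      using comm that by blast
  qed (use U(2,3) in simp_all)
  then obtain w where w: "w \<in> U" "w \<noteq> 0" "\<forall>k\<in>K. \<exists>c. \<rho> k w = scale c w" by blast
  from bchoice[OF w(3)] obtain r where r: "\<And>k. k \<in> K \<Longrightarrow> \<rho> k w = scale (r k) w" by blast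
  define N where "N k = (\<lambda>u. \<rho> k u - scale (r k) u)" for k
  have N: "endo (N k)" for k unfolding N_def by (rule endo_sub_scale[OF rho(2)])
  have formula: "(N k ^^ Suc m) (\<rho> x u)
      = \<rho> x ((N k ^^ Suc m) u) - scale (of_nat (Suc m)) (\<rho> (br x k) ((N k ^^ m) u))"
    if "k \<in> K" "u \<in> U" for k x u m
    unfolding N_def using funpow_commutator[OF repU comm[OF K[OF that(1)] that(1)] that(2)] .
  \<comment> \<open>The generalised eigenspace of \<open>\<rho> k\<close> for \<open>r k\<close> is
    a submodule: if \<open>N k ^^ m\<close> kills \<open>u\<close>, both terms of
    \<open>formula\<close> vanish, so one further power kills \<open>\<rho> x u\<close>. It contains
    \<open>w\<close>, hence is all of \<open>U\<close>.\<close>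
  have nil: "\<exists>m. (N k ^^ m) u = 0" if k: "k \<in> K" and u: "u \<in> U" for k u
  proof -
    let ?E = "{u \<in> U. \<exists>m. (N k ^^ m) u = 0}"
    have "?E = U"
    proof (rule min[THEN spec, THEN mp, THEN mp, THEN mp, THEN mp])
      show "subspace ?E" by (rule subspace_gen_eigenspace[OF N U(2)])
      have "(N k ^^ 1) w = 0" using r[OF k] by (simp add: N_def)
      then show "?E \<noteq> {0}" using w by blast
      show "\<forall>x. \<rho> x ` ?E \<subseteq> ?E"
      proof (intro allI image_subsetI)
        fix x u assume u: "u \<in> ?E"
        then obtain m where m: "(N k ^^ m) u = 0" "u \<in> U" by blast
        then have "(N k ^^ Suc m) u = 0" by (simp add: endo_zero[OF N])
        then have "(N k ^^ Suc m) (\<rho> x u) = 0"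
          using formula[OF k m(2), of m x] m(1) by (simp add: endo_zero[OF rho(2)] del: funpow.simps)
        then show "\<rho> x u \<in> ?E" using rho(4) m(2) by blast
      qed
    qed auto
    then show ?thesis using u by blast
  qed
  txt \<open>Commuting \<open>x\<close> past \<open>N k ^ n = 0\<close> with \<open>n\<close> minimal shows that \<open>\<rho> (br x k)\<close> has a
    nonzero kernel, while \<open>r (br x k)\<close> is its only eigenvalue.\<close>
  have r0: "r (br x k) = 0" if k: "k \<in> K" for x k
  proof -
    define n where "n = (LEAST n. \<forall>u\<in>U. (N k ^^ n) u = 0)"
    have n: "\<forall>u\<in>U. (N k ^^ n) u = 0" unfolding n_def
      by (rule LeastI_ex) (rule uniform_nilpotency_index[OF N U(2) nil[OF k]])
    have "n \<noteq> 0" using n w by (metis funpow_0)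
    then obtain m where m: "n = Suc m" using not0_implies_Suc by blast
    then have "m < (LEAST n. \<forall>u\<in>U. (N k ^^ n) u = 0)" by (simp add: n_def)
    then have "\<not> (\<forall>u\<in>U. (N k ^^ m) u = 0)" by (rule not_less_Least)
    then obtain u where u: "u \<in> U" "(N k ^^ m) u \<noteq> 0" by blast
    let ?v = "(N k ^^ m) u"
    have "?v \<in> U"
      by (rule subspace_funpow[OF _ u(1)]) (auto simp: N_def rho(4) U(2) subspace_diff subspace_scale)
    then obtain j where j: "(N (br x k) ^^ j) ?v = 0" using nil[OF K[OF k]] by blast
    have "scale (of_nat (Suc m)) (\<rho> (br x k) ?v) = 0"
      using formula[OF k u(1), of m x] n[unfolded m] u(1) rho(4)[OF u(1)]
      by (simp add: endo_zero[OF rho(2)] del: funpow.simps of_nat_Suc)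
    then have av: "\<rho> (br x k) ?v = 0" by (simp del: of_nat_Suc)
    \<comment> \<open>On \<open>?v\<close> the operator \<open>\<rho> (br x k)\<close> is 0, so
      \<open>N (br x k)\<close> is multiplication by \<open>- r (br x k)\<close>. Some power of it
      kills the nonzero \<open>?v\<close>, hence this scalar is 0.\<close>
    have "(N (br x k) ^^ j) ?v = scale ((- r (br x k)) ^ j) ?v" for j
      by (induction j) (simp_all add: endo_scale[OF rho(2)] N_def[of "br x k"] av)
    then show ?thesis using j u(2) by simp
  qed
  \<comment> \<open>Since \<open>r (br x k) = 0\<close>, the operators \<open>\<rho> k\<close> and
    \<open>\<rho> x\<close> commute on the joint eigenspace, which is therefore a submodule.\<close>
  have scalar: "\<rho> k u = scale (r k) u" if "k \<in> K" "u \<in> U" for k u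
  proof -
    let ?T = "{u \<in> U. \<forall>k\<in>K. \<rho> k u = scale (r k) u}"
    have "?T = U"
    proof (rule min[THEN spec, THEN mp, THEN mp, THEN mp, THEN mp])
      show "subspace ?T"
        using U(2) by (auto intro!: subspaceI simp: subspace_0 subspace_add subspace_scale
            endo_add[OF rho(2)] endo_scale[OF rho(2)] endo_zero[OF rho(2)] scale_right_distrib mult.commute)
      show "?T \<noteq> {0}" using w r by blast
      show "\<forall>x. \<rho> x ` ?T \<subseteq> ?T"
      proof (intro allI image_subsetI)
        fix x u assume u: "u \<in> ?T"
        have "\<rho> k (\<rho> x u) = scale (r k) (\<rho> x u)" if k: "k \<in> K" for k
        proof -
          have "\<rho> (br x k) u = 0" using u K[OF k] r0[OF k] by simp
          then have "\<rho> k (\<rho> x u) = \<rho> x (\<rho> k u)" using rho(6)[of u x k] u by simp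
          then show ?thesis using u k by (simp add: endo_scale[OF rho(2)])
        qed
        then show "\<rho> x u \<in> ?T" using u rho(4) by blast
      qed
    qed auto
    then show ?thesis using that by blast
  qed
  obtain B where B: "B \<subseteq> U" "independent B" "U \<subseteq> span B"
    by (rule basis_exists[of U]) (rule that)
  have spB: "span B = U" using B(1,3) U(2) by (simp add: span_subspace)
  have "B \<noteq> {}" using spB U(3) by auto
  then have card: "card B \<noteq> 0" using finiteI_independent[OF B(2)] by simp
  \<comment> \<open>The trace of the scalar \<open>r k\<close> is \<open>r k\<close> times the
    dimension of \<open>U\<close>, a nonzero number.\<close>
  have "r k = 0" if k: "k \<in> K" for k
  proof -
    have "trace_on B (\<rho> k) = r k * of_nat (card B)"
      unfolding trace_on_homothety[OF B(2), symmetric]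
      using scalar[OF k] B(1) by (intro trace_on_cong) auto
    then show ?thesis using trace_rep_perfect[OF perfect repU B(2) spB, of k] card by simp
  qed
  then have "\<forall>k\<in>K. \<rho> k w = 0" using r by simp
  then show ?thesis using w U(4) by blast
qed

text \<open>Let \<open>Z n\<close> be the common kernel of the \<open>n\<close>-th derived ideal. On
  \<open>Z (Suc n)\<close> the \<open>n\<close>-th derived ideal acts by commuting operators, since
  its brackets act as 0, so the commuting case makes \<open>Z n\<close> nonzero. The descent starts
  where the derived series is \<open>{0}\<close> and \<open>Z n = W\<close>, and ends at
  \<open>Z 0\<close>.\<close>

lemma solvable_ideal_kernel:
  assumes perfect: "brackets UNIV UNIV = UNIV" and rep: "lie_rep \<rho> W" and "W \<noteq> {0}"
    and K: "ideal_of K UNIV" "solvable K"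
  shows "\<exists>w\<in>W. w \<noteq> 0 \<and> (\<forall>k\<in>K. \<rho> k w = 0)"
proof -
  note rho = lie_repD[OF rep]
  define Z where "Z n = {w \<in> W. \<forall>k \<in> derived_series K n. \<rho> k w = 0}" for n
  have ideal: "br x k \<in> derived_series K n" if "k \<in> derived_series K n" for x k n
    using ideal_derived_series[OF K(1), of n] that by (auto simp: ideal_of_def)
  have sub: "subspace (Z n)" for n
    unfolding Z_def using rho(1) by (auto intro!: subspaceI simp: subspace_0 subspace_add subspace_scale
        endo_add[OF rho(2)] endo_scale[OF rho(2)] endo_zero[OF rho(2)])
  have repZ: "lie_rep \<rho> (Z n)" for n
  proof (rule lie_rep_subspace[OF rep sub])
    show "\<rho> x ` Z n \<subseteq> Z n" for x
    proof (rule image_subsetI)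
      fix w assume w: "w \<in> Z n"
      have "\<rho> k (\<rho> x w) = 0" if k: "k \<in> derived_series K n" for k
        using rho(6)[of w x k] w k ideal[OF k, of x] by (simp add: Z_def endo_zero[OF rho(2)])
      then show "\<rho> x w \<in> Z n" using w rho(4) by (auto simp: Z_def)
    qed
  qed (auto simp: Z_def)
  have step: "Z n \<noteq> {0}" if Suc: "Z (Suc n) \<noteq> {0}" for n
  proof -
    have "\<exists>w\<in>Z (Suc n). w \<noteq> 0 \<and> (\<forall>k\<in>derived_series K n. \<rho> k w = 0)"
    proof (rule commuting_ideal_kernel[OF perfect repZ Suc])
      fix k l w assume "k \<in> derived_series K n" "l \<in> derived_series K n" "w \<in> Z (Suc n)"
      then show "\<rho> k (\<rho> l w) = \<rho> l (\<rho> k w)"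
        using rho(6)[of w k l] br_in_brackets by (auto simp: Z_def)
    qed (rule ideal)
    then show ?thesis by (auto simp: Z_def)
  qed
  have all: "Z n \<noteq> {0} \<Longrightarrow> Z 0 \<noteq> {0}" for n by (induction n) (simp_all add: step)
  obtain n where "derived_series K n = {0}" using K(2) by (auto simp: solvable_def)
  then have "Z n = W" by (auto simp: Z_def endo_zero[OF rho(5)])
  then have "Z 0 \<noteq> {0}" using all assms(3) by blast
  then obtain w where "w \<in> Z 0" "w \<noteq> 0" using subspace_0[OF sub[of 0]] by blast
  then show ?thesis by (auto simp: Z_def)
qed

text \<open>Choose a maximal proper submodule \<open>S\<close> of \<open>M\<close>. In the simple
  module \<open>M / S\<close> the vectors killed by \<open>H\<close> form a nonzero submodule, hence
  everything, so \<open>brackets H M\<close> lies in \<open>S\<close>.\<close>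

lemma solvable_ideal_brackets_neq:
  assumes perfect: "brackets UNIV UNIV = UNIV"
    and H: "ideal_of H UNIV" "solvable H" and M: "ideal_of M UNIV" "M \<noteq> {0}"
  shows "brackets H M \<noteq> M"
proof -
  have sM: "subspace M" and stM: "\<And>x m. m \<in> M \<Longrightarrow> br x m \<in> M"
    using M(1) by (auto simp: ideal_of_def)
  have zero: "{0} \<subset> M" "\<forall>x. \<forall>s\<in>{0}. br x s \<in> {0}"
    using M(2) subspace_0[OF sM] by (auto simp: br_zero_right)
  obtain S where S: "\<forall>x. \<forall>s\<in>S. br x s \<in> S" "subspace S" "S \<subset> M"
    and max: "\<forall>T. (\<forall>x. \<forall>s\<in>T. br x s \<in> T) \<longrightarrow> subspace T \<longrightarrow> S \<subseteq> T \<longrightarrow> T \<subset> M \<longrightarrow> T = S"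
    using maximal_subspace_exists[of "\<lambda>S. \<forall>x. \<forall>s\<in>S. br x s \<in> S", OF zero(2) subspace_single_0 zero(1)]
    by (elim exE conjE) (rule that)
  obtain p where p: "endo p" "\<And>x. x \<in> S \<Longrightarrow> p x = 0" "\<And>x. x - p x \<in> S"
    using projection_exists[OF S(2)] by blast
  have p0: "p x = 0 \<longleftrightarrow> x \<in> S" for x using p(2,3)[of x] by auto
  have pM: "p m \<in> M" if "m \<in> M" for m
    using subspace_diff[OF sM that, of "m - p m"] p(3)[of m] S(3) by auto
  \<comment> \<open>\<open>br x\<close> preserves \<open>S\<close>, so replacing \<open>y\<close> by
    \<open>p y\<close> changes the bracket only by an element of \<open>S\<close>, which
    \<open>p\<close> kills. This makes \<open>?\<rho>\<close> a representation.\<close>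
  have pbr: "p (br x (p y)) = p (br x y)" for x y
  proof -
    have "p (br x (y - p y)) = 0" using S(1) p(3) p(2) by blast
    then show ?thesis by (simp add: br_diff_right endo_diff[OF p(1)])
  qed
  let ?\<rho> = "\<lambda>x v. p (br x v)"
  let ?W = "p ` M"
  have rep: "lie_rep ?\<rho> ?W"
    unfolding lie_rep_def
  proof (intro conjI allI ballI)
    show "subspace ?W"
    proof (rule subspaceI)
      show "0 \<in> ?W" using subspace_0[OF sM] endo_zero[OF p(1)] by (metis imageI)
      show "x + y \<in> ?W" if "x \<in> ?W" "y \<in> ?W" for x y
        using that by (auto simp: endo_add[OF p(1), symmetric] intro!: imageI subspace_add[OF sM])
      show "scale c x \<in> ?W" if "x \<in> ?W" for c x
        using that by (auto simp: endo_scale[OF p(1), symmetric] intro!: imageI subspace_scale[OF sM])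
    qed
    show "endo (?\<rho> x)" for x by (rule endo_compose[OF p(1) linear_br_right])
    show "endo (\<lambda>x. ?\<rho> x w)" for w by (rule endo_compose[OF p(1) linear_br_left])
    show "?\<rho> x ` ?W \<subseteq> ?W" for x using stM pM by blast
    show "?\<rho> (br x y) w = ?\<rho> x (?\<rho> y w) - ?\<rho> y (?\<rho> x w)" for x y w
      by (simp add: pbr br_br endo_diff[OF p(1)])
  qed
  have "?W \<noteq> {0}"
  proof
    assume "?W = {0}"
    then have "M \<subseteq> S" using p0 by blast
    then show False using S(3) by blast
  qed
  then obtain w where w: "w \<in> ?W" "w \<noteq> 0" "\<forall>h\<in>H. p (br h w) = 0"
    using solvable_ideal_kernel[OF perfect rep _ H] by blast
  \<comment> \<open>The preimage in \<open>M\<close> of the part of \<open>M / S\<close> killed by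
    \<open>H\<close>; it is a submodule containing both \<open>S\<close> and the vector
    \<open>w\<close>.\<close>
  let ?T = "{m \<in> M. \<forall>h\<in>H. br h m \<in> S}"
  have T: "?T = M"
  proof (rule ccontr)
    assume "?T \<noteq> M"
    have "?T = S"
    proof (rule max[THEN spec, THEN mp, THEN mp, THEN mp, THEN mp])
      show "\<forall>x. \<forall>s\<in>?T. br x s \<in> ?T"
      proof (intro allI ballI)
        fix x m assume m: "m \<in> ?T"
        have "br h (br x m) \<in> S" if h: "h \<in> H" for h
        proof -
          have "br x h \<in> H" using H(1) h by (auto simp: ideal_of_def)
          then have "br (br h x) m \<in> S"
            using m subspace_neg[OF S(2), of "br (br x h) m"]
            unfolding br_antisym[of h x] br_neg_left by simp
          moreover have "br x (br h m) \<in> S" using m h S(1) by blast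
          ultimately show ?thesis by (simp add: jacobi_derivation[of h x m] subspace_add[OF S(2)])
        qed
        then show "br x m \<in> ?T" using m stM by blast
      qed
      show "subspace ?T"
        using sM S(2) by (auto intro!: subspaceI simp: subspace_0 subspace_add subspace_scale
            br_zero_right br_add_right br_scale_right)
      show "S \<subseteq> ?T" using S(1,3) by blast
      show "?T \<subset> M" using \<open>?T \<noteq> M\<close> by blast
    qed
    moreover have "w \<in> ?T" using w pM p0 by blast
    ultimately have "p w = 0" using p(2) by blast
    \<comment> \<open>\<open>p\<close> is idempotent and so fixes \<open>w\<close>, which is
      nonzero; hence \<open>w\<close> cannot lie in \<open>S\<close>.\<close>
    moreover obtain m where "w = p m" using w(1) by blast
    then have "p w = w" using p(2)[OF p(3)[of m]] by (simp add: endo_diff[OF p(1)])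
    ultimately show False using w(2) by simp
  qed
  have "brackets H M \<subseteq> S" using T by (intro brackets_least[OF S(2)]) blast
  then show ?thesis using S(3) by blast
qed

section \<open>Gradings and derivations\<close>

lemma direct_sum_unique:
  assumes "direct_sum I Y H" "\<And>i. i \<in> I \<Longrightarrow> v i \<in> Y i" "\<And>i. i \<in> I \<Longrightarrow> w i \<in> Y i"
    and "(\<Sum>i\<in>I. v i) = (\<Sum>i\<in>I. w i)" "i \<in> I"
  shows "v i = w i"
proof -
  have sub: "\<And>i. i \<in> I \<Longrightarrow> subspace (Y i)"
    and indep: "\<forall>v. (\<forall>i\<in>I. v i \<in> Y i) \<and> (\<Sum>i\<in>I. v i) = 0 \<longrightarrow> (\<forall>i\<in>I. v i = 0)"
    using assms(1) unfolding direct_sum_def by (elim conjE; simp)+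
  have "(\<forall>i\<in>I. v i - w i \<in> Y i) \<and> (\<Sum>i\<in>I. v i - w i) = 0"
    using assms(2-4) by (simp add: sum_subtractf subspace_diff[OF sub])
  from mp[OF spec[OF indep] this] show ?thesis using assms(5) by simp
qed

text \<open>\<open>D\<close> multiplies the component in \<open>Y i\<close> by \<open>d i\<close>.
  On homogeneous pairs the Leibniz rule is additivity of degrees, and bilinearity extends it to all
  pairs.\<close>

lemma graded_derivation_exists:
  assumes ds: "direct_sum I Y UNIV"
    and grading: "\<And>i j x y. i \<in> I \<Longrightarrow> j \<in> I \<Longrightarrow> x \<in> Y i \<Longrightarrow> y \<in> Y j \<Longrightarrow>
      br x y = 0 \<or> (\<exists>p\<in>I. br x y \<in> Y p \<and> d p = d i + d j)"
  shows "\<exists>D\<in>derivations. \<forall>i\<in>I. \<forall>x\<in>Y i. D x = scale (d i) x"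
proof -
  have fin: "finite I" and sub: "\<And>i. i \<in> I \<Longrightarrow> subspace (Y i)"
    and sums: "UNIV = {\<Sum>i\<in>I. v i |v. \<forall>i\<in>I. v i \<in> Y i}"
    using ds by (simp_all add: direct_sum_def)
  have "\<forall>x. \<exists>v. (\<forall>i\<in>I. v i \<in> Y i) \<and> x = (\<Sum>i\<in>I. v i)" using sums by auto
  from choice[OF this] obtain c where "\<forall>x. (\<forall>i\<in>I. c x i \<in> Y i) \<and> x = (\<Sum>i\<in>I. c x i)" by (elim exE)
  then have cY: "\<And>x i. i \<in> I \<Longrightarrow> c x i \<in> Y i" and csum: "\<And>x. (\<Sum>i\<in>I. c x i) = x" by auto
  define D where "D x = (\<Sum>i\<in>I. scale (d i) (c x i))" for x
  \<comment> \<open>The components \<open>c x i\<close> are merely chosen, but directness makes them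
    unique, so \<open>D\<close> can be computed from any decomposition. Linearity follows by adding
    or scaling components.\<close>
  have D_sum: "D (\<Sum>i\<in>I. v i) = (\<Sum>i\<in>I. scale (d i) (v i))" if v: "\<And>i. i \<in> I \<Longrightarrow> v i \<in> Y i" for v
    unfolding D_def
  proof (rule sum.cong[OF refl])
    fix i assume i: "i \<in> I"
    have "c (\<Sum>i\<in>I. v i) i = v i"
      by (rule direct_sum_unique[OF ds cY v csum i])
    then show "scale (d i) (c (\<Sum>i\<in>I. v i) i) = scale (d i) (v i)" by simp
  qed
  have endoD: "endo D"
  proof (rule endoI)
    fix x y
    have "D (\<Sum>i\<in>I. c x i + c y i) = (\<Sum>i\<in>I. scale (d i) (c x i + c y i))"
      by (rule D_sum) (auto intro!: subspace_add sub cY)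
    then show "D (x + y) = D x + D y"
      by (simp add: sum.distrib csum scale_right_distrib D_def)
  next
    fix a x
    have "D (\<Sum>i\<in>I. scale a (c x i)) = (\<Sum>i\<in>I. scale (d i) (scale a (c x i)))"
      by (rule D_sum) (auto intro!: subspace_scale sub cY)
    then have "D (scale a x) = (\<Sum>i\<in>I. scale (d i) (scale a (c x i)))"
      by (simp only: scale_sum_right[symmetric] csum)
    also have "\<dots> = scale a (D x)"
      unfolding D_def scale_sum_right by (simp add: mult.commute)
    finally show "D (scale a x) = scale a (D x)" .
  qed
  have D_homog: "D x = scale (d i) x" if i: "i \<in> I" and x: "x \<in> Y i" for i x
  proof -
    have "D (\<Sum>j\<in>I. if j = i then x else 0) = (\<Sum>j\<in>I. scale (d j) (if j = i then x else 0))"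
      by (rule D_sum) (use x subspace_0[OF sub] in auto)
    also have "(\<Sum>j\<in>I. scale (d j) (if j = i then x else 0)) = (\<Sum>j\<in>I. if j = i then scale (d j) x else 0)"
      by (rule sum.cong) auto
    finally show ?thesis using i fin by (simp add: sum.delta)
  qed
  have D_br: "D (br x y) = scale (d i + d j) (br x y)"
    if ij: "i \<in> I" "j \<in> I" "x \<in> Y i" "y \<in> Y j" for i j x y
    using grading[OF ij]
  proof
    assume "br x y = 0"
    then show ?thesis by (simp add: endo_zero[OF endoD])
  next
    assume "\<exists>p\<in>I. br x y \<in> Y p \<and> d p = d i + d j"
    then obtain p where "p \<in> I" "br x y \<in> Y p" "d p = d i + d j" by blast
    then show ?thesis using D_homog[of p "br x y"] by simp
  qed
  have leibniz: "D (br x y) = br (D x) y + br x (D y)" for x y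
  proof -
    have xy: "br x y = (\<Sum>i\<in>I. \<Sum>j\<in>I. br (c x i) (c y j))"
      unfolding br_sum_right[symmetric] br_sum_left[symmetric] csum ..
    have "D (br x y) = (\<Sum>i\<in>I. \<Sum>j\<in>I. D (br (c x i) (c y j)))"
      unfolding xy by (simp only: endo_sum[OF endoD])
    also have "\<dots> = (\<Sum>i\<in>I. \<Sum>j\<in>I. scale (d i) (br (c x i) (c y j)) + scale (d j) (br (c x i) (c y j)))"
      by (intro sum.cong refl) (simp add: D_br[OF _ _ cY cY] scale_left_distrib)
    also have "\<dots> = (\<Sum>i\<in>I. \<Sum>j\<in>I. scale (d i) (br (c x i) (c y j)))
        + (\<Sum>i\<in>I. \<Sum>j\<in>I. scale (d j) (br (c x i) (c y j)))"
      by (simp only: sum.distrib)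
    also have "(\<Sum>i\<in>I. \<Sum>j\<in>I. scale (d i) (br (c x i) (c y j))) = br (D x) (\<Sum>j\<in>I. c y j)"
      
      unfolding D_def br_sum_left by (simp only: br_sum_right br_scale_left scale_sum_right)
    also have "(\<Sum>i\<in>I. \<Sum>j\<in>I. scale (d j) (br (c x i) (c y j))) = br (\<Sum>i\<in>I. c x i) (D y)"
      
      unfolding D_def br_sum_left by (simp only: br_sum_right br_scale_right)
    finally show ?thesis by (simp only: csum)
  qed
  have "D \<in> derivations" using endoD leibniz by (simp add: derivations_def)
  then show ?thesis using D_homog by blast
qed

text \<open>Bridges the two descriptions of a sum of summands: families of vectors, as in
  \<open>direct_sum\<close>, and spans, which suit brackets.\<close>

lemma span_UN_eq_sums:
  assumes fin: "finite T" and sub: "\<And>i. i \<in> T \<Longrightarrow> subspace (V i)"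
  shows "span (\<Union>i\<in>T. V i) = {\<Sum>i\<in>T. v i |v. \<forall>i\<in>T. v i \<in> V i}" (is "_ = ?S")
proof
  show "?S \<subseteq> span (\<Union>i\<in>T. V i)"
    by (clarify, intro span_sum span_base) blast
  show "span (\<Union>i\<in>T. V i) \<subseteq> ?S"
  proof (rule span_minimal)
    show "(\<Union>i\<in>T. V i) \<subseteq> ?S"
    proof (rule subsetI)
      fix x assume "x \<in> (\<Union>i\<in>T. V i)"
      then obtain i where i: "i \<in> T" "x \<in> V i" by blast
      have "x = (\<Sum>j\<in>T. if j = i then x else 0)" using i fin by (simp add: sum.delta)
      moreover have "\<forall>j\<in>T. (if j = i then x else 0) \<in> V j"
        using i subspace_0[OF sub] by auto
      ultimately show "x \<in> ?S" by (intro CollectI exI[of _ "\<lambda>j. if j = i then x else 0"]) simp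
    qed
    show "subspace ?S"
    proof (rule subspaceI)
      show "0 \<in> ?S" using subspace_0[OF sub] by (intro CollectI exI[of _ "\<lambda>_. 0"]) simp
    next
      fix x y assume "x \<in> ?S" "y \<in> ?S"
      then obtain v w where "x = (\<Sum>i\<in>T. v i)" "y = (\<Sum>i\<in>T. w i)" "\<forall>i\<in>T. v i \<in> V i" "\<forall>i\<in>T. w i \<in> V i"
        by auto
      then show "x + y \<in> ?S"
        using subspace_add[OF sub] by (intro CollectI exI[of _ "\<lambda>i. v i + w i"]) (simp add: sum.distrib)
    next
      fix a x assume "x \<in> ?S"
      then obtain v where "x = (\<Sum>i\<in>T. v i)" "\<forall>i\<in>T. v i \<in> V i" by auto
      then show "scale a x \<in> ?S"
        using subspace_scale[OF sub] by (intro CollectI exI[of _ "\<lambda>i. scale a (v i)"]) (simp add: scale_sum_right)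
    qed
  qed
qed

lemma direct_sum_span: "direct_sum I V H \<Longrightarrow> H = span (\<Union>i\<in>I. V i)"
  by (subst span_UN_eq_sums) (auto simp: direct_sum_def)

text \<open>Compare two decompositions of \<open>x\<close>, one supported on \<open>T\<close> and
  one concentrated at \<open>p\<close>; uniqueness of components at \<open>p\<close> gives
  0.\<close>

lemma direct_sum_inter_span:
  assumes ds: "direct_sum I V H" and T: "T \<subseteq> I" and p: "p \<in> I" "p \<notin> T"
    and x: "x \<in> V p" "x \<in> span (\<Union>i\<in>T. V i)"
  shows "x = 0"
proof -
  have fin: "finite I" and sub: "\<And>i. i \<in> I \<Longrightarrow> subspace (V i)"
    using ds by (simp_all add: direct_sum_def)
  obtain v where v: "x = (\<Sum>i\<in>T. v i)" "\<forall>i\<in>T. v i \<in> V i"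
    using x(2) span_UN_eq_sums[of T V] finite_subset[OF T fin] sub T by auto
  let ?v = "\<lambda>i. if i \<in> T then v i else 0" and ?w = "\<lambda>i. if i = p then x else 0"
  have "?v p = ?w p"
  proof (rule direct_sum_unique[OF ds, of ?v ?w])
    have "(\<Sum>i\<in>I. ?v i) = (\<Sum>i\<in>I \<inter> T. v i)" by (simp add: sum.inter_restrict[OF fin])
    also have "\<dots> = (\<Sum>i\<in>I. ?w i)"
      using T p(1) fin v(1) by (simp add: Int_absorb1)
    finally show "(\<Sum>i\<in>I. ?v i) = (\<Sum>i\<in>I. ?w i)" .
  qed (use v x(1) p(1) subspace_0[OF sub] in auto)
  then show ?thesis using p(2) by simp
qed

text \<open>Adds the complement \<open>L\<close> as one more summand under a fresh index, so that a
  grading of \<open>H\<close> extends to the whole Lie algebra.\<close>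

lemma direct_sum_insert:
  assumes ds: "direct_sum I V H" and L: "subspace L" "L \<inter> H = {0}"
    and U: "{x + y |x y. x \<in> L \<and> y \<in> H} = UNIV" and k: "k \<notin> I"
  shows "direct_sum (insert k I) (V(k := L)) UNIV"
proof -
  have fin: "finite I" and sub: "\<And>i. i \<in> I \<Longrightarrow> subspace (V i)"
    and sums: "H = {\<Sum>i\<in>I. v i |v. \<forall>i\<in>I. v i \<in> V i}"
    and indep: "\<And>v. (\<forall>i\<in>I. v i \<in> V i) \<Longrightarrow> (\<Sum>i\<in>I. v i) = 0 \<Longrightarrow> (\<forall>i\<in>I. v i = 0)"
    using ds unfolding direct_sum_def by blast+
  have V: "(V(k := L)) i = V i" if "i \<in> I" for i using that k by auto
  have split: "(\<Sum>i\<in>insert k I. v i) = v k + (\<Sum>i\<in>I. v i)" for v :: "_ \<Rightarrow> 'a"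
    using fin k by simp
  show ?thesis
    unfolding direct_sum_def
  proof (intro conjI allI impI)
    show "finite (insert k I)" using fin by simp
    show "\<forall>i\<in>insert k I. subspace ((V(k := L)) i)" using L(1) sub by auto
    show "UNIV = {\<Sum>i\<in>insert k I. v i |v. \<forall>i\<in>insert k I. v i \<in> (V(k := L)) i}"
    proof (rule sym, rule UNIV_eq_I[symmetric])
      fix z
      obtain x y where xy: "z = x + y" "x \<in> L" "y \<in> H" using U by blast
      then obtain v where v: "y = (\<Sum>i\<in>I. v i)" "\<forall>i\<in>I. v i \<in> V i" using sums by blast
      have "(\<Sum>i\<in>I. (v(k := x)) i) = (\<Sum>i\<in>I. v i)" by (rule sum.cong) (use k in auto)
      then have "z = (\<Sum>i\<in>insert k I. (v(k := x)) i)"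
        by (simp add: split xy v del: fun_upd_apply) simp
      moreover have "\<forall>i\<in>insert k I. (v(k := x)) i \<in> (V(k := L)) i" using v xy k by auto
      ultimately show "z \<in> {\<Sum>i\<in>insert k I. v i |v. \<forall>i\<in>insert k I. v i \<in> (V(k := L)) i}"
        by (intro CollectI exI[of _ "v(k := x)"] conjI)
    qed
  next
    fix v assume v: "(\<forall>i\<in>insert k I. v i \<in> (V(k := L)) i) \<and> (\<Sum>i\<in>insert k I. v i) = 0"
    then have vI: "\<forall>i\<in>I. v i \<in> V i" and vk: "v k \<in> L" using V by auto
    then have H: "(\<Sum>i\<in>I. v i) \<in> H" unfolding sums by blast
    have eq: "v k = - (\<Sum>i\<in>I. v i)" using v by (simp add: split eq_neg_iff_add_eq_0)
    have "(\<Sum>i\<in>I. v i) = - v k" by (simp add: eq)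
    then have "(\<Sum>i\<in>I. v i) \<in> L" using subspace_neg[OF L(1) vk] by simp
    then have 0: "(\<Sum>i\<in>I. v i) = 0" using H L(2) by blast
    then show "\<forall>i\<in>insert k I. v i = 0" using indep[OF vI] eq by simp
  qed
qed

section \<open>The lower central series on index sets\<close>

lemma br_in_span:
  assumes "a \<in> span A" "b \<in> span B" "subspace S" "\<And>x y. x \<in> A \<Longrightarrow> y \<in> B \<Longrightarrow> br x y \<in> S"
  shows "br a b \<in> S"
proof -
  have 1: "span B \<subseteq> {y. br x y \<in> S}" if "x \<in> A" for x
    using assms(4)[OF that] by (intro span_minimal subspace_br_vimage assms(3)) auto
  have "span A \<subseteq> {x. br x b \<in> S}"
  proof (rule span_minimal)
    show "A \<subseteq> {x. br x b \<in> S}" using 1 assms(2) by blast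
    show "subspace {x. br x b \<in> S}"
      using assms(3) by (auto intro!: subspaceI simp: br_zero_left br_add_left br_scale_left
          subspace_0 subspace_add subspace_scale)
  qed
  then show ?thesis using assms(1) by blast
qed

text \<open>Index version of bracketing with the radical: it sends the index set of a sum
  \<open>M\<close> of summands to that of \<open>brackets H M\<close>. Iterating it from
  \<open>I\<close> gives the lower central series as a chain of finite sets.\<close>

definition bracket_step :: "'i set \<Rightarrow> ('i \<Rightarrow> 'a set) \<Rightarrow> 'i set \<Rightarrow> 'i set" where
  "bracket_step I V T = {p \<in> I. \<exists>i\<in>I. \<exists>j\<in>T. brackets (V i) (V j) = V p}"

lemma bracket_step_mono: "S \<subseteq> T \<Longrightarrow> bracket_step I V S \<subseteq> bracket_step I V T"
  by (auto simp: bracket_step_def)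

lemma bracket_step_subset: "bracket_step I V T \<subseteq> I"
  by (auto simp: bracket_step_def)

lemma brackets_span_bracket_step:
  assumes "T \<subseteq> I"
    and graded: "\<And>i j. i \<in> I \<Longrightarrow> j \<in> I \<Longrightarrow> brackets (V i) (V j) \<noteq> {0} \<Longrightarrow>
      \<exists>p\<in>I. brackets (V i) (V j) = V p"
  shows "brackets (span (\<Union>i\<in>I. V i)) (span (\<Union>i\<in>T. V i)) = span (\<Union>i\<in>bracket_step I V T. V i)"
    (is "?B = ?S")
proof
  show "?B \<subseteq> ?S"
  proof (rule brackets_least[OF subspace_span], erule (1) br_in_span[OF _ _ subspace_span])
    fix x y assume "x \<in> (\<Union>i\<in>I. V i)" "y \<in> (\<Union>i\<in>T. V i)"
    then obtain i j where ij: "i \<in> I" "j \<in> T" "x \<in> V i" "y \<in> V j" by blast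
    have xy: "br x y \<in> brackets (V i) (V j)" using ij by (intro br_in_brackets)
    show "br x y \<in> ?S"
    proof (cases "brackets (V i) (V j) = {0}")
      case True
      then show ?thesis using xy span_zero by simp
    next
      case False
      then obtain p where p: "p \<in> I" "brackets (V i) (V j) = V p"
        using graded ij assms(1) by blast
      then have "p \<in> bracket_step I V T" using ij by (auto simp: bracket_step_def)
      then show ?thesis using xy p(2) by (intro span_base) auto
    qed
  qed
  show "?S \<subseteq> ?B"
  proof (rule span_minimal[OF _ subspace_brackets])
    have "V p \<subseteq> ?B" if "p \<in> bracket_step I V T" for p
    proof -
      from that obtain i j where ij: "i \<in> I" "j \<in> T" "brackets (V i) (V j) = V p"
        by (auto simp: bracket_step_def)
      have "V i \<subseteq> span (\<Union>i\<in>I. V i)" "V j \<subseteq> span (\<Union>i\<in>T. V i)"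
        using ij(1,2) by (auto intro: span_base)
      then have "brackets (V i) (V j) \<subseteq> ?B" by (rule brackets_mono)
      then show ?thesis using ij(3) by simp
    qed
    then show "(\<Union>i\<in>bracket_step I V T. V i) \<subseteq> ?B" by blast
  qed
qed

lemma ideal_span_bracket_step:
  assumes "ideal_of (span (\<Union>i\<in>I. V i)) UNIV" "ideal_of (span (\<Union>i\<in>T. V i)) UNIV" "T \<subseteq> I"
    and "\<And>i j. i \<in> I \<Longrightarrow> j \<in> I \<Longrightarrow> brackets (V i) (V j) \<noteq> {0} \<Longrightarrow> \<exists>p\<in>I. brackets (V i) (V j) = V p"
  shows "ideal_of (span (\<Union>i\<in>bracket_step I V T. V i)) UNIV"
  using ideal_brackets[OF assms(1,2)] brackets_span_bracket_step[OF assms(3,4)] by simp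

text \<open>A fixed nonempty index set would give a nonzero ideal \<open>M\<close> with
  \<open>brackets H M = M\<close>.\<close>

lemma bracket_step_neq:
  assumes perfect: "brackets UNIV UNIV = UNIV"
    and H: "ideal_of (span (\<Union>i\<in>I. V i)) UNIV" "solvable (span (\<Union>i\<in>I. V i))"
    and T: "ideal_of (span (\<Union>i\<in>T. V i)) UNIV" "T \<subseteq> I" "T \<noteq> {}"
    and V: "\<And>i. i \<in> I \<Longrightarrow> subspace (V i) \<and> V i \<noteq> {0}"
    and graded: "\<And>i j. i \<in> I \<Longrightarrow> j \<in> I \<Longrightarrow> brackets (V i) (V j) \<noteq> {0} \<Longrightarrow>
      \<exists>p\<in>I. brackets (V i) (V j) = V p"
  shows "bracket_step I V T \<noteq> T"
proof
  assume eq: "bracket_step I V T = T"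
  obtain i where i: "i \<in> T" using T(3) by blast
  then have "V i \<noteq> {0}" "V i \<subseteq> span (\<Union>i\<in>T. V i)" "0 \<in> V i"
    using V[of i] T(2) span_base[of _ "\<Union>i\<in>T. V i"] subspace_0 by auto
  then have "span (\<Union>i\<in>T. V i) \<noteq> {0}" by auto
  from solvable_ideal_brackets_neq[OF perfect H T(1) this]
  show False using brackets_span_bracket_step[OF T(2) graded] eq by simp
qed

text \<open>The chain \<open>I\<close>, \<open>T2\<close>, \<open>T3\<close>, \<open>T4\<close>
  drops strictly until it is empty. If \<open>T3\<close> is empty, degrees 1 and 2 suffice;
  otherwise the sizes are 3, 2, 1, 0 and the three summands get degrees 1, 2, 3.\<close>

lemma positive_grading_exists:
  assumes perfect: "brackets UNIV UNIV = UNIV"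
    and ds: "direct_sum I V H" and I: "card I = 3"
    and H: "ideal_of H UNIV" "solvable H"
    and V0: "\<And>i. i \<in> I \<Longrightarrow> V i \<noteq> {0}"
    and graded: "\<And>i j. i \<in> I \<Longrightarrow> j \<in> I \<Longrightarrow> brackets (V i) (V j) \<noteq> {0} \<Longrightarrow>
      \<exists>p\<in>I. brackets (V i) (V j) = V p"
  shows "\<exists>d::'i \<Rightarrow> nat. (\<forall>i. d i > 0) \<and>
    (\<forall>i\<in>I. \<forall>j\<in>I. \<forall>p\<in>I. brackets (V i) (V j) = V p \<longrightarrow> d p = d i + d j)"
proof -
  have fin: "finite I" and sub: "\<And>i. i \<in> I \<Longrightarrow> subspace (V i)"
    using ds by (simp_all add: direct_sum_def)
  have V: "subspace (V i) \<and> V i \<noteq> {0}" if "i \<in> I" for i using sub V0 that by blast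
  \<comment> \<open>Summands may be isomorphic, but as subspaces they are distinct, so a bracket
    equal to one summand is not equal to another.\<close>
  have V_inj: "p = q" if "p \<in> I" "q \<in> I" "V p = V q" for p q
  proof (rule ccontr)
    assume "p \<noteq> q"
    then have "x = 0" if "x \<in> V p" for x
      using direct_sum_inter_span[OF ds, of "{q}" p x] that \<open>p \<in> I\<close> \<open>q \<in> I\<close> \<open>V p = V q\<close>
      by (auto intro: span_base)
    then show False using V[OF \<open>p \<in> I\<close>] subspace_0 by blast
  qed
  note Hspan = H[unfolded direct_sum_span[OF ds]]
  note ideal = ideal_span_bracket_step[OF Hspan(1) _ _ graded]
  note neq = bracket_step_neq[OF perfect Hspan _ _ _ V graded]
  define T2 where "T2 = bracket_step I V I"
  define T3 where "T3 = bracket_step I V T2"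
  define T4 where "T4 = bracket_step I V T3"
  have sub2: "T2 \<subseteq> I" and sub3: "T3 \<subseteq> T2" and sub4: "T4 \<subseteq> T3"
    unfolding T4_def T3_def T2_def
    by (intro bracket_step_subset bracket_step_mono)+
  have id2: "ideal_of (span (\<Union>i\<in>T2. V i)) UNIV"
    unfolding T2_def by (rule ideal[OF Hspan(1) subset_refl])
  have id3: "ideal_of (span (\<Union>i\<in>T3. V i)) UNIV"
    unfolding T3_def by (rule ideal[OF id2 sub2])
  have n2: "T2 \<noteq> I" unfolding T2_def
    using I by (intro neq[OF Hspan(1)]) auto
  have n3: "T3 \<noteq> T2" if "T2 \<noteq> {}" unfolding T3_def using that by (rule neq[OF id2 sub2])
  have n4: "T4 \<noteq> T3" if "T3 \<noteq> {}" unfolding T4_def using that sub2 sub3 by (intro neq[OF id3]) auto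
  have T2I: "p \<in> T2" if "i \<in> I" "j \<in> I" "p \<in> I" "brackets (V i) (V j) = V p" for i j p
    using that by (auto simp: T2_def bracket_step_def)
  have T3I: "p \<in> T3" if "i \<in> I" "j \<in> I" "p \<in> I" "brackets (V i) (V j) = V p" "i \<in> T2 \<or> j \<in> T2" for i j p
    using that brackets_commute[of "V i" "V j"] by (auto simp: T3_def bracket_step_def)
  have T4I: "p \<in> T4" if "i \<in> I" "j \<in> I" "p \<in> I" "brackets (V i) (V j) = V p" "i \<in> T3 \<or> j \<in> T3" for i j p
    using that brackets_commute[of "V i" "V j"] by (auto simp: T4_def bracket_step_def)
  show ?thesis
  proof (cases "T3 = {}")
    case True
    \<comment> \<open>As \<open>T3\<close> is empty, a bracket equal to \<open>V p\<close> has both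
      factors outside \<open>T2\<close>, while \<open>p\<close> lies in \<open>T2\<close>: degrees 1
      + 1 = 2.\<close>
    let ?d = "\<lambda>i. if i \<in> T2 then 2 else 1 :: nat"
    have "?d p = ?d i + ?d j" if "i \<in> I" "j \<in> I" "p \<in> I" "brackets (V i) (V j) = V p" for i j p
      using T2I[OF that] T3I[OF that] True by auto
    then show ?thesis by (intro exI[of _ ?d]) auto
  next
    case False
    have "T2 \<noteq> {}" using False sub3 by blast
    have c: "card T4 < card T3" "card T3 < card T2" "card T2 < card I"
      using n2 n3[OF \<open>T2 \<noteq> {}\<close>] n4[OF False] sub2 sub3 sub4 fin
      by (meson finite_subset psubset_card_mono psubsetI)+
    then have "card T4 = 0" "card T3 = 1" "card T2 = 2" using I by auto
    then have T4: "T4 = {}" using fin sub2 sub3 sub4 by (metis card_0_eq finite_subset)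
    obtain e where e: "T3 = {e}" using \<open>card T3 = 1\<close> card_1_singletonE by blast
    have "card (T2 - {e}) = 1" using \<open>card T2 = 2\<close> sub3 e by (simp add: card_Diff_singleton)
    then obtain b where b: "T2 - {e} = {b}" using card_1_singletonE by blast
    have T2: "T2 = {b, e}" "b \<noteq> e" using b sub3 e by auto
    have "card (I - T2) = 1" using I \<open>card T2 = 2\<close> sub2 fin by (simp add: card_Diff_subset finite_subset)
    then obtain a where a: "I - T2 = {a}" using card_1_singletonE by blast
    have Ieq: "I = {a, b, e}" and ab: "a \<noteq> b" "a \<noteq> e" using a T2 sub2 by auto
    have mem: "a \<in> I" "b \<in> I" "e \<in> I" using Ieq by auto
    \<comment> \<open>\<open>V b\<close> is some bracket, but \<open>b\<close> is not in
      \<open>T3\<close>, so neither factor has its index in \<open>T2\<close>; only \<open>a\<close>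
      remains for both.\<close>
    have "b \<in> bracket_step I V I" using T2(1) by (simp add: T2_def)
    then obtain i j where ij: "i \<in> I" "j \<in> I" "brackets (V i) (V j) = V b"
      by (auto simp: bracket_step_def)
    then have "i \<notin> T2" "j \<notin> T2" using T3I[OF ij(1,2) mem(2) ij(3)] T2(2) e by auto
    then have "i = a" "j = a" using ij(1,2) a by blast+
    then have aab: "brackets (V a) (V a) = V b" using ij(3) by simp
    \<comment> \<open>A nonzero bracket with \<open>V e\<close> would put an index into the empty
      set \<open>T4\<close>.\<close>
    have ae: "brackets (V a) (V e) = {0}"
      using graded[OF mem(1,3)] T4I[OF mem(1,3)] T4 e by blast
    have ab_e: "brackets (V a) (V b) \<subseteq> V e"
    proof (cases "brackets (V a) (V b) = {0}")
      case True
      then show ?thesis using subspace_0[OF sub[OF mem(3)]] by simp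
    next
      case False
      then show ?thesis using graded[OF mem(1,2)] T3I[OF mem(1,2)] T2 e by blast
    qed
    txt \<open>Here \<open>V b\<close> and \<open>V e\<close> should have degrees 2 and 3, so \<open>[V b, V b] = V e\<close> must be
      excluded; it contradicts the Jacobi identity because \<open>V b = [V a, V a]\<close>.\<close>
    have "br u z = 0" if u: "u \<in> V b" and z: "z \<in> V b" for u z
    proof -
      \<comment> \<open>\<open>[V a, [V a, V b]]\<close> lies in \<open>[V a, V e] = 0\<close>,
        which kills both terms in the Jacobi expansion of \<open>br (br x y) z\<close>.\<close>
      have "br x (br y z) = 0" if "x \<in> V a" "y \<in> V a" for x y
      proof -
        have "br y z \<in> V e" using ab_e br_in_brackets that z by blast
        then show ?thesis using ae br_in_brackets[of x "V a" "br y z" "V e"] that by auto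
      qed
      then have "brackets (V a) (V a) \<subseteq> {u. br u z = 0}"
        by (intro brackets_least)
          (auto intro!: subspaceI simp: br_br br_zero_left br_add_left br_scale_left)
      then show ?thesis using u aab by blast
    qed
    then have "brackets (V b) (V b) \<subseteq> {0}" by (intro brackets_least) auto
    then have bb: "brackets (V b) (V b) \<noteq> V e"
      using V[OF mem(3)] subspace_0 by blast
    \<comment> \<open>The only possible brackets equal to a summand are
      \<open>[V a, V a] = V b\<close> and \<open>[V a, V b] = V e\<close> up to order, matching 1 +
      1 = 2 and 1 + 2 = 3.\<close>
    let ?d = "\<lambda>i. if i = a then 1 else if i = b then 2 else 3 :: nat"
    have "?d p = ?d i + ?d j"
      if ijp: "i \<in> I" "j \<in> I" "p \<in> I" "brackets (V i) (V j) = V p" for i j p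
    proof -
      have ije: "i \<noteq> e" "j \<noteq> e" using T4I[OF ijp] T4 e by auto
      have p: "p = b \<or> p = e" using T2I[OF ijp] T2 by auto
      show ?thesis
      proof (cases "p = b")
        case True
        then have "i \<notin> T2" "j \<notin> T2" using T3I[OF ijp] e T2(2) by auto
        then show ?thesis using True ijp(1,2) Ieq T2 ab by auto
      next
        case False
        then have pe: "p = e" using p by blast
        have "\<not> (i = a \<and> j = a)" using V_inj[OF mem(2,3)] T2(2) aab ijp(4) pe by auto
        moreover have "\<not> (i = b \<and> j = b)" using bb ijp(4) pe by auto
        ultimately show ?thesis using ijp(1,2) ije Ieq pe ab T2(2) by auto
      qed
    qed
    then show ?thesis by (intro exI[of _ ?d]) auto
  qed
qed

section \<open>The degree derivation is not inner\<close>

lemma simple_centraliser: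
  assumes L: "simple L" and l: "l \<in> L" "\<And>y. y \<in> L \<Longrightarrow> br l y = 0"
  shows "l = 0"
proof -
  let ?Z = "{z \<in> L. \<forall>y\<in>L. br z y = 0}"
  have sL: "subspace L" and cl: "\<And>x y. x \<in> L \<Longrightarrow> y \<in> L \<Longrightarrow> br x y \<in> L"
    using L by (auto simp: simple_def subalgebra_def)
  have "ideal_of ?Z L"
    unfolding ideal_of_def
  proof (intro conjI ballI)
    show "subspace ?Z"
      using sL by (auto intro!: subspaceI simp: subspace_0 subspace_add subspace_scale
          br_zero_left br_add_left br_scale_left)
    show "br x z \<in> ?Z" if "x \<in> L" "z \<in> ?Z" for x z
      using that cl by (simp add: br_br br_zero_right)
  qed blast
  then have "?Z = {0} \<or> ?Z = L" using L by (simp add: simple_def)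
  \<comment> \<open>The centre of \<open>L\<close> is an ideal; were it all of \<open>L\<close>, the
    brackets of \<open>L\<close> would vanish, against simplicity.\<close>
  moreover have "?Z \<noteq> L"
  proof
    assume "?Z = L"
    then have "brackets L L \<subseteq> {0}" by (intro brackets_least) auto
    then show False using L subspace_0[OF subspace_brackets, of L L] by (auto simp: simple_def)
  qed
  moreover have "l \<in> ?Z" using l by blast
  ultimately show ?thesis by blast
qed

lemma derived_series_perfect: "brackets A A = A \<Longrightarrow> derived_series A n = A"
  by (induction n) simp_all

text \<open>With \<open>L\<close> in degree 0 the positive grading of \<open>H\<close> gives a
  derivation \<open>D\<close>. If \<open>D = br x\<close>, then the \<open>L\<close>-part of
  \<open>x\<close> centralises \<open>L\<close> and vanishes, and the remaining \<open>h\<close> in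
  \<open>H\<close> acts invertibly on every \<open>V i\<close>, forcing
  \<open>brackets H H = H\<close>.\<close>

lemma not_sympathetic_of_three_summands:
  fixes V :: "nat \<Rightarrow> 'a set"
  assumes levi: "levi_decomposition L H" and L: "simple L"
    and perfect: "brackets UNIV UNIV = UNIV"
    and ds: "direct_sum I V H" and I: "card I = 3" "0 \<notin> I"
    and mods: "\<And>i. i \<in> I \<Longrightarrow> simple_module L (V i)"
    and graded: "\<And>i j. i \<in> I \<Longrightarrow> j \<in> I \<Longrightarrow> brackets (V i) (V j) \<noteq> {0} \<Longrightarrow>
      \<exists>p\<in>I. brackets (V i) (V j) = V p"
  shows "\<not> sympathetic"
proof
  assume symp: "sympathetic"
  have H: "ideal_of H UNIV" "solvable H" and LH: "L \<inter> H = {0}"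
    and sumLH: "{x + y |x y. x \<in> L \<and> y \<in> H} = UNIV"
    using levi by (auto simp: levi_decomposition_def is_radical_def)
  have sL: "subspace L" and cl: "\<And>x y. x \<in> L \<Longrightarrow> y \<in> L \<Longrightarrow> br x y \<in> L"
    using L by (auto simp: simple_def subalgebra_def)
  have V: "V i \<noteq> {0}" "subspace (V i)" "\<And>x v. x \<in> L \<Longrightarrow> v \<in> V i \<Longrightarrow> br x v \<in> V i" if "i \<in> I" for i
    using mods[OF that] by (auto simp: simple_module_def submodule_def)
  have VH: "V i \<subseteq> H" if "i \<in> I" for i
    unfolding direct_sum_span[OF ds] using that by (auto intro: span_base)
  from positive_grading_exists[OF perfect ds I(1) H V(1) graded]
  obtain d :: "nat \<Rightarrow> nat" where dpos: "\<And>i. d i > 0"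
    and d: "\<And>i j p. i \<in> I \<Longrightarrow> j \<in> I \<Longrightarrow> p \<in> I \<Longrightarrow> brackets (V i) (V j) = V p \<Longrightarrow> d p = d i + d j"
    by blast
  \<comment> \<open>Index 0 is free and is given to \<open>L\<close>; the value of \<open>d\<close>
    there is arbitrary, so it is overridden by 0.\<close>
  let ?I = "insert 0 I" and ?Y = "V(0 := L)" and ?d = "\<lambda>i. of_nat (if i = 0 then 0 else d i) :: complex"
  have Y: "?Y i = V i" if "i \<in> I" for i using that I(2) by auto
  have "\<exists>D\<in>derivations. \<forall>i\<in>?I. \<forall>x\<in>?Y i. D x = scale (?d i) x"
  proof (rule graded_derivation_exists[OF direct_sum_insert[OF ds sL LH sumLH I(2)]])
    fix i j x y assume ij: "i \<in> ?I" "j \<in> ?I" and xy: "x \<in> ?Y i" "y \<in> ?Y j"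
    consider "i = 0" | "i \<in> I" "j = 0" | "i \<in> I" "j \<in> I" using ij by blast
    then show "br x y = 0 \<or> (\<exists>p\<in>?I. br x y \<in> ?Y p \<and> ?d p = ?d i + ?d j)"
    proof cases
      case 1
      then have "br x y \<in> ?Y j" using xy ij cl V(3) by (cases "j = 0") auto
      then show ?thesis using 1 ij(2) by (intro disjI2 bexI[of _ j]) auto
    next
      case 2
      have "br y x \<in> V i" using V(3)[OF 2(1)] xy 2 Y by auto
      then have "br x y \<in> V i" unfolding br_antisym[of x y] by (rule subspace_neg[OF V(2)[OF 2(1)]])
      then show ?thesis using 2 Y by (intro disjI2 bexI[of _ i]) auto
    next
      case 3
      have in_br: "br x y \<in> brackets (V i) (V j)" using xy Y 3 by (auto intro: br_in_brackets)
      show ?thesis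
      proof (cases "brackets (V i) (V j) = {0}")
        case True
        then show ?thesis using in_br by simp
      next
        case False
        then obtain p where p: "p \<in> I" "brackets (V i) (V j) = V p" using graded 3 by blast
        have "i \<noteq> 0" "j \<noteq> 0" "p \<noteq> 0" using 3 p I(2) by metis+
        then show ?thesis using in_br p d[OF 3 p] by (intro disjI2 bexI[of _ p]) auto
      qed
    qed
  qed
  then obtain D where D: "D \<in> derivations" "\<And>i x. i \<in> ?I \<Longrightarrow> x \<in> ?Y i \<Longrightarrow> D x = scale (?d i) x" by blast
  have "D \<in> inner_derivations" using D(1) symp by (simp add: sympathetic_def)
  then obtain x where x: "D = br x" by (auto simp: inner_derivations_def)
  obtain l h where lh: "x = l + h" "l \<in> L" "h \<in> H" using sumLH by blast
  \<comment> \<open>\<open>D\<close> vanishes on \<open>L\<close>, so \<open>br l y\<close> in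
    \<open>L\<close> is the negative of \<open>br h y\<close> in \<open>H\<close>; the intersection
    of \<open>L\<close> and \<open>H\<close> is trivial.\<close>
  have "br l y = 0" if y: "y \<in> L" for y
  proof -
    have "br l y + br h y = 0" using D(2)[of 0 y] y by (simp add: x lh(1) br_add_left)
    then have "br l y = br y h" unfolding br_antisym[of y h] by (simp add: eq_neg_iff_add_eq_0)
    moreover have "br y h \<in> H" using H(1) lh(3) by (auto simp: ideal_of_def)
    ultimately show ?thesis using cl[OF lh(2) y] LH by auto
  qed
  then have "l = 0" by (rule simple_centraliser[OF L lh(2)])
  then have xh: "x = h" using lh(1) by simp
  have sH: "subspace H" using H(1) by (simp add: ideal_of_def)
  \<comment> \<open>\<open>br h\<close> multiplies \<open>V i\<close> by the nonzero number
    \<open>d i\<close>, so every \<open>v\<close> is a scalar multiple of the bracket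
    \<open>br h v\<close>.\<close>
  have "V i \<subseteq> brackets H H" if i: "i \<in> I" for i
  proof
    fix v assume v: "v \<in> V i"
    have "i \<noteq> 0" using i I(2) by metis
    then have "br h v = scale (of_nat (d i)) v" using D(2)[of i v] i v by (simp add: x xh)
    moreover have "br h v \<in> brackets H H" using lh(3) v VH[OF i] by (intro br_in_brackets) auto
    ultimately have "scale (inverse (of_nat (d i))) (scale (of_nat (d i)) v) \<in> brackets H H"
      using subspace_scale[OF subspace_brackets] by metis
    then show "v \<in> brackets H H" using dpos[of i] by simp
  qed
  then have "H \<subseteq> brackets H H"
    by (subst direct_sum_span[OF ds]) (intro span_minimal subspace_brackets, blast)
  moreover have "brackets H H \<subseteq> H"
    using H(1) by (intro brackets_least[OF sH]) (auto simp: ideal_of_def)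
  \<comment> \<open>\<open>H\<close> now equals all terms of its derived series, and solvability
    makes one of them zero.\<close>
  ultimately have "H = {0}"
    using H(2) derived_series_perfect[of H] by (auto simp: solvable_def)
  obtain i where i: "i \<in> I" using I(1) by (metis card.empty equals0I zero_neq_numeral)
  show False using VH[OF i] V(1,2)[OF i] subspace_0 \<open>H = {0}\<close> by blast
qed

end

theorem theorem3p12:
  fixes scale :: "complex \<Rightarrow> 'a::ab_group_add \<Rightarrow> 'a"
    and br :: "'a \<Rightarrow> 'a \<Rightarrow> 'a"
    and L H :: "'a set"
    and V :: "nat \<Rightarrow> 'a set"
  assumes "fd_complex_lie_algebra scale br"
    and "fd_complex_lie_algebra.levi_decomposition scale br L H"
    and "fd_complex_lie_algebra.simple scale br L"
    and "fd_complex_lie_algebra.brackets scale br UNIV UNIV = UNIV"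
    and "fd_complex_lie_algebra.centre br = {0}"
    and "fd_complex_lie_algebra.direct_sum scale {1, 2, 3} V H"
    and "\<forall>i\<in>{1, 2, 3}. fd_complex_lie_algebra.simple_module scale br L (V i)"
    and "\<forall>i\<in>{1, 2, 3}. \<forall>j\<in>{1, 2, 3}.
           fd_complex_lie_algebra.brackets scale br (V i) (V j) \<noteq> {0} \<longrightarrow>
           (\<exists>!p. p \<in> {1, 2, 3} \<and> fd_complex_lie_algebra.brackets scale br (V i) (V j) = V p)"
  shows "\<not> fd_complex_lie_algebra.sympathetic scale br"
proof -
  interpret fd_complex_lie_algebra scale br by fact
  show ?thesis
  \<comment> \<open>Here \<open>I = {1, 2, 3}\<close>, which leaves the index 0 free for the Levi
    factor.\<close>
  proof (rule not_sympathetic_of_three_summands[OF assms(2-4,6)])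
    show "simple_module L (V i)" if "i \<in> {1, 2, 3}" for i
      using assms(7) that by (rule bspec)
    show "\<exists>p\<in>{1, 2, 3}. brackets (V i) (V j) = V p"
      if "i \<in> {1, 2, 3}" "j \<in> {1, 2, 3}" "brackets (V i) (V j) \<noteq> {0}" for i j
    proof -
      have "\<exists>!p. p \<in> {1, 2, 3} \<and> brackets (V i) (V j) = V p"
        by (rule mp[OF bspec[OF bspec[OF assms(8) that(1)] that(2)] that(3)])
      then show ?thesis by (elim ex1E conjE) (rule bexI)
    qed
  qed simp_all
qed

end
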